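(* Let $p\ge2$, let $U$ be uniformly distributed on $\mathbb S^{p-1}$, and let $T:\mathbb S^{p-1}\to\mathbb R^p$ be a measurable vector field with $u^\top T(u)=0$ for Haar-almost every $u$. Conditional on $U$, let $V$ be Haar-uniform on the unit sphere in $U^\perp$, and define $$R:=\|T(U)\|,\qquad Z_T:=T(U)^\top V,\qquad H_T:=\frac1{1+R^2}.$$ Then $$H_T\sim\mathrm{Beta}\Bigl(\tfrac12,\tfrac{p-1}2\Bigr)\quad\Longleftrightarrow\quad Z_T\sim\mathrm{Cauchy}(0,1).$$
   Context: $\mathrm{Cauchy}(0,1)$ is the standard Cauchy law on $\mathbb R$. When $p=2$ the unit sphere in $U^\perp$ consists of two points, and Haar-uniform means each has probability $1/2$. *)

theory Defs
  imports "HOL-Probability.Probability"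
begin

abbreviation unit_sphere_borel :: "'a::euclidean_space measure" where
  "unit_sphere_borel \<equiv> restrict_space borel (sphere 0 1)"

text \<open>
  Haar-uniform measures on the unit sphere of a linear subspace \<open>S\<close>, as measures on the ambient
  space: probability measures carried by that sphere and invariant under the orthogonal group of
  \<open>S\<close>.  Every orthogonal map of \<open>S\<close> extends to an orthogonal map of the whole space preserving
  \<open>S\<close>, so quantifying over the latter gives all of the orthogonal group.  Reflections are
  included, so for a line \<open>S\<close> each of the two unit vectors has probability 1/2.
\<close>

definition haar_uniform_on_unit_sphere :: "'a::euclidean_space set \<Rightarrow> 'a measure \<Rightarrow> bool" where
  "haar_uniform_on_unit_sphere S \<mu> \<longleftrightarrow>
     prob_space \<mu> \<and> sets \<mu> = sets borel \<and> measure \<mu> (S \<inter> sphere 0 1) = 1 \<and>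
     (\<forall>f. orthogonal_transformation f \<and> f ` S = S \<longrightarrow> distr \<mu> borel f = \<mu>)"

text \<open>\<open>\<kappa> x\<close> is a regular version of the conditional law of \<open>Y\<close> given \<open>X = x\<close>.\<close>

definition regular_conditional_law ::
  "'w measure \<Rightarrow> 'b measure \<Rightarrow> 'c measure \<Rightarrow> ('w \<Rightarrow> 'b) \<Rightarrow> ('w \<Rightarrow> 'c) \<Rightarrow> ('b \<Rightarrow> 'c measure) \<Rightarrow> bool"
  where
  "regular_conditional_law M N L X Y \<kappa> \<longleftrightarrow>
     \<kappa> \<in> N \<rightarrow>\<^sub>M prob_algebra L \<and>
     (\<forall>A\<in>sets N. \<forall>B\<in>sets L.
        emeasure M {\<omega> \<in> space M. X \<omega> \<in> A \<and> Y \<omega> \<in> B} =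
        (\<integral>\<^sup>+x\<in>A. emeasure (\<kappa> x) B \<partial>distr M N X))"

definition beta_density :: "real \<Rightarrow> real \<Rightarrow> real \<Rightarrow> real" where
  "beta_density a b x =
     (if 0 < x \<and> x < 1 then x powr (a - 1) * (1 - x) powr (b - 1) / Beta a b else 0)"

definition cauchy_density :: "real \<Rightarrow> real \<Rightarrow> real \<Rightarrow> real" where
  "cauchy_density m s x = 1 / (pi * s * (1 + ((x - m) / s)\<^sup>2))"

end

theory Submission
  imports Defs
begin

text \<open>
  Write \<open>n = CARD('n)\<close> and \<open>d = n - 1\<close>.  Given \<open>U = u\<close>, the vector \<open>T u\<close> lies in the hyperplane
  \<open>u\<^sup>\<bottom>\<close>, so by rotation invariance \<open>T u \<bullet> V\<close> has the law of \<open>norm (T u) * W\<close>, where \<open>W\<close> is one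
  coordinate of a uniform point of the unit sphere in dimension \<open>d\<close>
  (\<open>haar_uniform_inner_scale\<close>).  The law of \<open>W\<close> does not depend on \<open>u\<close>; integrating over \<open>u\<close>,
  the variable \<open>Z\<close> has the law of \<open>R * W\<close> with \<open>R\<close> and \<open>W\<close> \<^emph>\<open>independent\<close>.  The theorem is
  therefore about multiplicative convolution of laws on the real line (\<open>mult_conv\<close>).

  Let \<open>S\<close> be the norm of a standard Gaussian vector in dimension \<open>d\<close>, and let \<open>Y\<close> be a standard
  normal variable; distinct variables in the products and ratios below are independent.  Both sides of the equivalence say the
  same thing, namely that \<open>R\<close> has the law of \<open>S / \<bar>Y\<bar>\<close>.

  \<^item> A Gaussian vector is its norm times a uniform direction, so \<open>S * W\<close> is standard normal
    (\<open>chi_law_mult_haar\<close>).  Hence \<open>(S / \<bar>Y\<bar>) * W = (S * W) / \<bar>Y\<bar>\<close> is a ratio of two normal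
    variables, which is Cauchy (\<open>std_normal_ratio_cauchy\<close>).

  \<^item> The variable \<open>1 / (1 + (S / \<bar>Y\<bar>)\<^sup>2) = Y\<^sup>2 / (Y\<^sup>2 + S\<^sup>2)\<close> has law \<open>Beta (1/2, d/2)\<close>
    (\<open>chi_ratio_beta\<close>), and \<open>r \<mapsto> 1 / (1 + r\<^sup>2)\<close> is injective on \<open>r \<ge> 0\<close>.  This settles the side
    of \<open>H\<close>.

  \<^item> Conversely, if \<open>R * W\<close> is Cauchy then it has the law of \<open>(S / \<bar>Y\<bar>) * W\<close>.  Multiplying both by
    an independent copy of \<open>S\<close> turns the factor \<open>W\<close> into a standard normal \<open>G\<close>, so \<open>R * G\<close> and
    \<open>(S / \<bar>Y\<bar>) * G\<close> have the same law.  The characteristic function of \<open>R * G\<close> is the Laplace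
    transform of \<open>R\<^sup>2 / 2\<close>, so \<open>G\<close> can be cancelled (\<open>mult_conv_std_normal_cancel\<close>).
\<close>

section \<open>Multiplicative convolution of probability laws on the real line\<close>

lemma emeasure_distr_eq_nn_integral:
  assumes "g \<in> borel_measurable M" "X \<in> sets borel"
  shows "emeasure (distr M borel g) X = (\<integral>\<^sup>+x. indicator X (g x) \<partial>M)"
  using assms nn_integral_indicator[of X "distr M borel g"] nn_integral_distr[of g M borel "indicator X"]
  by simp

definition mult_conv :: "real measure \<Rightarrow> real measure \<Rightarrow> real measure"
  where "mult_conv A B = distr (A \<Otimes>\<^sub>M B) borel (\<lambda>(x, y). x * y)"

lemma real_distribution_mult_conv:
  assumes "real_distribution A" "real_distribution B"
  shows "real_distribution (mult_conv A B)"
proof -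
  interpret A: real_distribution A by fact
  interpret B: real_distribution B by fact
  interpret P: pair_prob_space A B ..
  show ?thesis
    unfolding mult_conv_def by (rule P.real_distribution_distr) measurable
qed

lemma nn_integral_mult_conv:
  assumes "real_distribution A" "real_distribution B" and [measurable]: "f \<in> borel_measurable borel"
  shows "(\<integral>\<^sup>+z. f z \<partial>mult_conv A B) = (\<integral>\<^sup>+x. \<integral>\<^sup>+y. f (x * y) \<partial>B \<partial>A)"
proof -
  interpret A: real_distribution A by fact
  interpret B: real_distribution B by fact
  have "(\<integral>\<^sup>+z. f z \<partial>mult_conv A B) = (\<integral>\<^sup>+p. f (fst p * snd p) \<partial>(A \<Otimes>\<^sub>M B))"
    unfolding mult_conv_def case_prod_beta by (rule nn_integral_distr) measurable
  also have "\<dots> = (\<integral>\<^sup>+x. \<integral>\<^sup>+y. f (fst (x, y) * snd (x, y)) \<partial>B \<partial>A)"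
    by (rule B.nn_integral_fst[symmetric]) measurable
  finally show ?thesis by simp
qed

lemma emeasure_mult_conv:
  assumes "real_distribution A" "real_distribution B" and [measurable]: "X \<in> sets borel"
  shows "emeasure (mult_conv A B) X = (\<integral>\<^sup>+x. \<integral>\<^sup>+y. indicator X (x * y) \<partial>B \<partial>A)"
  using nn_integral_mult_conv[OF assms(1,2), of "indicator X"]
  by (simp add: mult_conv_def)

lemma real_distribution_eqI:
  assumes "real_distribution A" "real_distribution B"
    and "\<And>X. X \<in> sets borel \<Longrightarrow> emeasure A X = emeasure B X"
  shows "A = B"
  using assms by (intro measure_eqI) (auto simp: real_distribution.events_eq_borel)

lemma mult_conv_assoc:
  assumes A: "real_distribution A" and B: "real_distribution B" and C: "real_distribution C"
  shows "mult_conv (mult_conv A B) C = mult_conv A (mult_conv B C)"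
proof (rule real_distribution_eqI)
  interpret A: real_distribution A by fact
  interpret B: real_distribution B by fact
  interpret C: real_distribution C by fact
  fix X :: "real set" assume [measurable]: "X \<in> sets borel"
  show "emeasure (mult_conv (mult_conv A B) C) X = emeasure (mult_conv A (mult_conv B C)) X"
    by (simp add: emeasure_mult_conv nn_integral_mult_conv A B C real_distribution_mult_conv
        mult.assoc)
qed (intro real_distribution_mult_conv A B C)+

lemma mult_conv_commute:
  assumes A: "real_distribution A" and B: "real_distribution B"
  shows "mult_conv A B = mult_conv B A"
proof (rule real_distribution_eqI)
  interpret A: real_distribution A by fact
  interpret B: real_distribution B by fact
  interpret P: pair_sigma_finite A B ..
  fix X :: "real set" assume [measurable]: "X \<in> sets borel"
  show "emeasure (mult_conv A B) X = emeasure (mult_conv B A) X"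
    by (simp add: emeasure_mult_conv A B, subst P.Fubini') (simp_all add: mult.commute)
qed (intro real_distribution_mult_conv A B)+


lemma AE_mult_conv_nonneg:
  assumes "real_distribution A" "real_distribution B" "AE x in A. 0 \<le> x" "AE y in B. 0 \<le> y"
  shows "AE z in mult_conv A B. 0 \<le> z"
proof -
  interpret A: real_distribution A by fact
  interpret B: real_distribution B by fact
  have "(\<integral>\<^sup>+x. \<integral>\<^sup>+y. indicator {..<0} (x * y) \<partial>B \<partial>A) = (\<integral>\<^sup>+x. 0 \<partial>A)"
    using assms(3)
  proof (intro nn_integral_cong_AE, eventually_elim)
    case (elim x)
    then have "0 \<le> y \<Longrightarrow> 0 \<le> x * y" for y by simp
    then have "AE y in B. indicator {..<0} (x * y) = (0::ennreal)"
      using assms(4) by (auto elim!: eventually_mono simp: indicator_def not_less)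
    then show ?case by (simp cong: nn_integral_cong_AE)
  qed
  then have "emeasure (mult_conv A B) {..<0} = 0"
    by (subst emeasure_mult_conv[OF assms(1,2)]) auto
  then show ?thesis
    by (intro AE_I[where N = "{..<0}"]) (auto simp: mult_conv_def)
qed

section \<open>Cancelling a Gaussian factor\<close>

text \<open>
  Given the other factor \<open>r\<close>, the product is normal with variance \<open>r\<^sup>2\<close>; so this characteristic
  function is a Laplace transform in \<open>r\<^sup>2\<close>.
\<close>

lemma char_mult_conv_std_normal:
  assumes A: "real_distribution A"
  shows "char (mult_conv A std_normal_distribution) t = (\<integral>r. exp (- (t\<^sup>2 * r\<^sup>2) / 2) \<partial>A)"
proof -
  interpret A: real_distribution A by fact
  interpret N: real_distribution std_normal_distribution by (rule real_dist_normal_dist)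
  interpret P: pair_prob_space A std_normal_distribution ..
  have "char (mult_conv A std_normal_distribution) t
      = (\<integral>p. iexp (t * (fst p * snd p)) \<partial>(A \<Otimes>\<^sub>M std_normal_distribution))"
    unfolding mult_conv_def char_def by (subst integral_distr) (auto simp: case_prod_beta)
  also have "\<dots> = (\<integral>r. (\<integral>y. iexp (t * (r * y)) \<partial>std_normal_distribution) \<partial>A)"
    by (subst P.integral_fst'[symmetric]) (auto intro!: P.integrable_const_bound[where B=1])
  also have "\<dots> = (\<integral>r. char std_normal_distribution (t * r) \<partial>A)"
    by (simp add: char_def mult.assoc)
  also have "\<dots> = (\<integral>r. complex_of_real (exp (- (t\<^sup>2 * r\<^sup>2) / 2)) \<partial>A)"
    by (simp add: char_std_normal_distribution power_mult_distrib)
  finally show ?thesis by simp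
qed

text \<open>
  On \<open>[-1, 1]\<close> all moments are bounded by 1, so the Taylor polynomials of \<open>exp (\<i> t x)\<close>, whose
  integrals involve only moments, approximate the characteristic function with error at most
  \<open>2 \<bar>t\<bar>\<^sup>n / n!\<close>.
\<close>

lemma real_distribution_moments_unique:
  assumes A: "real_distribution A" and B: "real_distribution B"
    and sA: "AE x in A. \<bar>x\<bar> \<le> 1" and sB: "AE x in B. \<bar>x\<bar> \<le> 1"
    and eq: "\<And>k. (\<integral>x. x ^ k \<partial>A) = (\<integral>x. x ^ k \<partial>B)"
  shows "A = B"
proof (rule Levy_uniqueness[OF A B], rule ext)
  fix t :: real
  define p where "p n = (\<Sum>k\<le>n. ((\<i> * t)^k / fact k) * (\<integral>x. x ^ k \<partial>A))" for n :: nat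
  have approx: "cmod (char D t - (\<Sum>k\<le>n. ((\<i> * t)^k / fact k) * (\<integral>x. x ^ k \<partial>D))) \<le> 2 * \<bar>t\<bar> ^ n / fact n"
    if D: "real_distribution D" and sD: "AE x in D. \<bar>x\<bar> \<le> 1" for D n
  proof -
    interpret D: real_distribution D by fact
    have le: "AE x in D. \<bar>x\<bar> ^ k \<le> 1" for k :: nat
      using sD by eventually_elim (auto intro: power_le_one)
    have int: "integrable D (\<lambda>x. x ^ k)" "integrable D (\<lambda>x. \<bar>x\<bar> ^ k)" for k :: nat
      using le by (auto intro!: D.integrable_const_bound[where B=1] simp: power_abs)
    have "D.expectation (\<lambda>x. \<bar>x\<bar> ^ n) \<le> 1"
      using D.integral_le_const[OF int(2) le] .
    then have "2 * \<bar>t\<bar> ^ n / fact n * D.expectation (\<lambda>x. \<bar>x\<bar> ^ n) \<le> 2 * \<bar>t\<bar> ^ n / fact n"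
      by (intro mult_left_le) auto
    with D.char_approx1[of n t, OF int(1)] show ?thesis by simp
  qed
  have lim: "(\<lambda>n. 2 * \<bar>t\<bar> ^ n / fact n) \<longlonglongrightarrow> 0"
    using tendsto_mult_left[OF summable_LIMSEQ_zero[OF summable_exp[of "\<bar>t\<bar>"]], of 2]
    by (simp add: field_simps)
  have "(\<lambda>n. char A t - p n) \<longlonglongrightarrow> 0"
    by (rule Lim_null_comparison[OF _ lim]) (use approx[OF A sA] in \<open>simp add: p_def\<close>)
  moreover have "(\<lambda>n. char B t - p n) \<longlonglongrightarrow> 0"
    by (rule Lim_null_comparison[OF _ lim]) (use approx[OF B sB] in \<open>simp add: p_def eq\<close>)
  ultimately have "(\<lambda>n. (char A t - p n) - (char B t - p n)) \<longlonglongrightarrow> 0 - 0"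
    by (rule tendsto_diff)
  then show "char A t = char B t" by (simp add: LIMSEQ_const_iff)
qed

text \<open>
  The characteristic function of the product, taken at \<open>t = sqrt (2 k)\<close>, is the mean of
  \<open>exp (- k r\<^sup>2)\<close>, which is the \<open>k\<close>-th moment of the variable \<open>exp (- r\<^sup>2)\<close> with values in \<open>(0, 1]\<close>.
  These moments determine its law, and for \<open>r \<ge> 0\<close> one recovers \<open>r\<close> from \<open>exp (- r\<^sup>2)\<close>.
  Signs are invisible to a symmetric factor, hence the restriction to nonnegative variables.
\<close>

lemma mult_conv_std_normal_cancel:
  assumes A: "real_distribution A" and B: "real_distribution B"
    and nA: "AE r in A. 0 \<le> r" and nB: "AE r in B. 0 \<le> r"
    and eq: "mult_conv A std_normal_distribution = mult_conv B std_normal_distribution"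
  shows "A = B"
proof -
  define q :: "real \<Rightarrow> real" where "q r = exp (- r\<^sup>2)" for r
  define q' :: "real \<Rightarrow> real" where "q' x = sqrt (- ln x)" for x
  have [measurable]: "q \<in> borel_measurable borel" "q' \<in> borel_measurable borel"
    by (simp_all add: q_def[abs_def] q'_def[abs_def])
  have rd: "real_distribution (distr D borel q)" if "real_distribution D" for D
    by (rule prob_space.real_distribution_distr)
       (use that in \<open>auto simp: real_distribution_def real_distribution.events_eq_borel measurable_cong_sets[OF real_distribution.events_eq_borel[OF that] refl]\<close>)
  have mom: "complex_of_real (\<integral>x. x ^ k \<partial>distr D borel q) = char (mult_conv D std_normal_distribution) (sqrt (2 * k))"
    if D: "real_distribution D" for D and k :: nat
  proof -
    interpret D: real_distribution D by fact
    show ?thesis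
      by (simp add: char_mult_conv_std_normal[OF D] integral_distr q_def exp_of_nat_mult[symmetric])
  qed
  have bd: "AE x in distr D borel q. \<bar>x\<bar> \<le> 1" if D: "real_distribution D" for D
  proof -
    interpret D: real_distribution D by fact
    show ?thesis by (subst AE_distr_iff) (auto simp: q_def)
  qed
  have recover: "distr (distr D borel q) borel q' = D" if D: "real_distribution D" and nD: "AE r in D. 0 \<le> r" for D
  proof -
    interpret D: real_distribution D by fact
    have "distr (distr D borel q) borel q' = distr D borel (\<lambda>r. q' (q r))"
      by (subst distr_distr) (auto simp: comp_def)
    also have "\<dots> = distr D borel (\<lambda>r. r)"
      using nD by (intro distr_cong_AE) (auto simp: q_def q'_def)
    also have "\<dots> = D" by (simp add: distr_id2)
    finally show ?thesis .
  qed
  have "distr A borel q = distr B borel q"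
  proof (rule real_distribution_moments_unique)
    fix k
    have "complex_of_real (\<integral>x. x ^ k \<partial>distr A borel q) = complex_of_real (\<integral>x. x ^ k \<partial>distr B borel q)"
      by (simp only: mom A B eq)
    then show "(\<integral>x. x ^ k \<partial>distr A borel q) = (\<integral>x. x ^ k \<partial>distr B borel q)"
      using of_real_eq_iff by blast
  qed (use A B rd bd in auto)
  then show ?thesis
    using recover[OF A nA] recover[OF B nB] by metis
qed

section \<open>One-dimensional marginals of Haar-uniform measures\<close>

text \<open>
  The reflection in the hyperplane orthogonal to \<open>c = a - b\<close> moves every vector by a multiple of \<open>c\<close>,
  so it preserves each subspace that contains both \<open>a\<close> and \<open>b\<close>.  This makes it admissible in the
  invariance property that defines Haar-uniform measures.
\<close>

lemma reflection_exchanging: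
  fixes a b :: "'a::euclidean_space"
  assumes "norm a = norm b"
  obtains f where "orthogonal_transformation f" "f a = b"
    "\<And>S. subspace S \<Longrightarrow> a \<in> S \<Longrightarrow> b \<in> S \<Longrightarrow> f ` S = S"
proof (cases "a = b")
  case True
  then show ?thesis by (intro that[of id]) (auto simp: orthogonal_transformation_id[unfolded id_def[symmetric]])
next
  case False
  define c where "c = a - b"
  define f where "f x = x - (2 * (x \<bullet> c) / (c \<bullet> c)) *\<^sub>R c" for x
  have c: "c \<noteq> 0" "c \<bullet> c \<noteq> 0" using False by (auto simp: c_def)
  have lin: "linear f"
    by (rule linearI) (auto simp: f_def inner_add_left algebra_simps add_divide_distrib)
  have "f v \<bullet> f w = v \<bullet> w" for v w
    using c by (simp add: f_def inner_diff_left inner_diff_right inner_commute field_simps)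
  then have orth: "orthogonal_transformation f"
    using lin by (simp add: orthogonal_transformation_def)
  have "a \<bullet> a = b \<bullet> b" using assms by (simp add: dot_square_norm)
  then have "2 * (a \<bullet> c) = c \<bullet> c"
    by (simp add: c_def inner_diff_left inner_diff_right inner_commute)
  then have "f a = b" using c by (simp add: f_def) (simp add: c_def)
  moreover have "f ` S = S" if S: "subspace S" "a \<in> S" "b \<in> S" for S
  proof -
    have cS: "c \<in> S" using S by (simp add: c_def subspace_diff)
    have sub: "f x \<in> S" if "x \<in> S" for x
      using that S cS by (simp add: f_def subspace_diff subspace_scale)
    have ff: "f (f x) = x" for x
    proof -
      have "f x \<bullet> c = - (x \<bullet> c)" using c by (simp add: f_def inner_diff_left)
      then show ?thesis by (simp add: f_def[of "f x"]) (simp add: f_def)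
    qed
    show ?thesis
    proof (rule set_eqI)
      show "x \<in> f ` S \<longleftrightarrow> x \<in> S" for x
        using sub image_eqI[of x f "f x" S] ff by (auto simp: ff)
    qed
  qed
  ultimately show ?thesis using orth that by blast
qed

lemma haar_uniform_AE_unit:
  assumes "haar_uniform_on_unit_sphere S \<mu>" "subspace S"
  shows "AE v in \<mu>. v \<in> S \<and> norm v = 1"
proof -
  interpret prob_space \<mu> using assms by (simp add: haar_uniform_on_unit_sphere_def)
  have [measurable_cong]: "sets \<mu> = sets borel"
    using assms by (simp add: haar_uniform_on_unit_sphere_def)
  have "closed (S \<inter> sphere 0 1)" 
    by (intro closed_Int closed_subspace assms closed_sphere)
  then have "S \<inter> sphere 0 1 \<in> events" by (simp add: \<open>sets \<mu> = sets borel\<close>)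
  moreover have "prob (S \<inter> sphere 0 1) = 1" using assms by (simp add: haar_uniform_on_unit_sphere_def)
  ultimately have "AE v in \<mu>. v \<in> S \<inter> sphere 0 1" by (simp add: prob_eq_1)
  then show ?thesis by eventually_elim auto
qed

lemma haar_uniform_measurable_eq:
  assumes "haar_uniform_on_unit_sphere S \<mu>"
  shows "sets \<mu> = sets borel" "measurable \<mu> N = measurable borel N" "prob_space \<mu>"
  using assms by (auto simp: haar_uniform_on_unit_sphere_def cong: measurable_cong_sets)

lemma haar_uniform_inner_rotate:
  fixes a b :: "'a::euclidean_space"
  assumes \<mu>: "haar_uniform_on_unit_sphere S \<mu>" and S: "subspace S" "a \<in> S" "b \<in> S" "norm a = norm b"
  shows "distr \<mu> borel ((\<bullet>) a) = distr \<mu> borel ((\<bullet>) b)"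
proof -
  obtain f where f: "orthogonal_transformation f" "f a = b" "f ` S = S"
    by (rule reflection_exchanging[OF S(4)]) (use S in blast)
  have fm: "f \<in> borel_measurable borel"
    using f(1) by (intro borel_measurable_continuous_onI linear_continuous_on
        linear_conv_bounded_linear[THEN iffD1] orthogonal_transformation_linear)
  have "distr \<mu> borel ((\<bullet>) b) = distr (distr \<mu> borel f) borel ((\<bullet>) b)"
    using \<mu> f by (simp add: haar_uniform_on_unit_sphere_def)
  also have "\<dots> = distr \<mu> borel (\<lambda>v. b \<bullet> f v)"
    using fm by (subst distr_distr) (auto simp: haar_uniform_measurable_eq[OF \<mu>] comp_def)
  also have "(\<lambda>v. b \<bullet> f v) = (\<bullet>) a"
    using f by (auto simp: orthogonal_transformation_def)
  finally show ?thesis by simp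
qed

text \<open>
  Let \<open>v\<close> and \<open>w\<close> be independent with laws \<open>\<mu>\<close> and \<open>\<nu>\<close>, and consider \<open>f v \<bullet> w\<close>.  For fixed \<open>v\<close> it
  has the law of a marginal of \<open>\<nu>\<close> in a unit direction, and all of these agree.  For fixed \<open>w = f w'\<close>
  it equals \<open>v \<bullet> w'\<close>, which has the law of a marginal of \<open>\<mu>\<close> in a unit direction.  By Fubini the two
  marginal laws coincide.
\<close>

lemma haar_uniform_inner_unique:
  fixes f :: "'a::euclidean_space \<Rightarrow> 'a"
  assumes \<mu>: "haar_uniform_on_unit_sphere S \<mu>" and \<nu>: "haar_uniform_on_unit_sphere S' \<nu>"
    and S: "subspace S" "subspace S'"
    and f: "orthogonal_transformation f" "f ` S = S'"
    and a: "a \<in> S" "norm a = 1" and b: "b \<in> S'" "norm b = 1"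
  shows "distr \<mu> borel ((\<bullet>) a) = distr \<nu> borel ((\<bullet>) b)"
proof (rule measure_eqI)
  interpret \<mu>: prob_space \<mu> using haar_uniform_measurable_eq[OF \<mu>] by simp
  interpret \<nu>: prob_space \<nu> using haar_uniform_measurable_eq[OF \<nu>] by simp
  interpret P: pair_sigma_finite \<mu> \<nu> ..
  note [measurable_cong] = haar_uniform_measurable_eq(1)[OF \<mu>] haar_uniform_measurable_eq(1)[OF \<nu>]
  fix X :: "real set" assume "X \<in> sets (distr \<mu> borel ((\<bullet>) a))"
  then have [measurable]: "X \<in> sets borel" by simp
  have [measurable]: "f \<in> borel_measurable borel"
    using f(1) by (intro borel_measurable_continuous_onI linear_continuous_on
        linear_conv_bounded_linear[THEN iffD1] orthogonal_transformation_linear)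
  have law: "emeasure (distr \<mu> borel ((\<bullet>) c)) X = (\<integral>\<^sup>+v. indicator X (c \<bullet> v) \<partial>\<mu>)" for c
    by (rule emeasure_distr_eq_nn_integral) measurable
  have law': "emeasure (distr \<nu> borel ((\<bullet>) c)) X = (\<integral>\<^sup>+w. indicator X (c \<bullet> w) \<partial>\<nu>)" for c
    by (rule emeasure_distr_eq_nn_integral) measurable
  have nf: "norm (f v) = norm v" for v
    using f(1) by (rule orthogonal_transformation_norm)
  have "emeasure (distr \<nu> borel ((\<bullet>) b)) X
      = (\<integral>\<^sup>+v. emeasure (distr \<nu> borel ((\<bullet>) b)) X \<partial>\<mu>)"
    by (simp add: \<mu>.emeasure_space_1)
  also have "\<dots> = (\<integral>\<^sup>+v. \<integral>\<^sup>+w. indicator X (f v \<bullet> w) \<partial>\<nu> \<partial>\<mu>)"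
    using haar_uniform_AE_unit[OF \<mu> S(1)]
  proof (intro nn_integral_cong_AE, eventually_elim)
    case (elim v)
    then have "f v \<in> S'" "norm (f v) = norm b" using f(2) b nf by auto
    from haar_uniform_inner_rotate[OF \<nu> S(2) this(1) b(1) this(2)]
    show ?case by (simp add: law'[symmetric])
  qed
  also have "\<dots> = (\<integral>\<^sup>+w. \<integral>\<^sup>+v. indicator X (f v \<bullet> w) \<partial>\<mu> \<partial>\<nu>)"
    by (subst P.Fubini') auto
  also have "\<dots> = (\<integral>\<^sup>+w. emeasure (distr \<mu> borel ((\<bullet>) a)) X \<partial>\<nu>)"
    using haar_uniform_AE_unit[OF \<nu> S(2)]
  proof (intro nn_integral_cong_AE, eventually_elim)
    case (elim w)
    then obtain w' where w': "w' \<in> S" "w = f w'" using f(2) by auto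
    have "(\<integral>\<^sup>+v. indicator X (f v \<bullet> w) \<partial>\<mu>) = emeasure (distr \<mu> borel ((\<bullet>) w')) X"
      unfolding law w' using f(1) by (simp add: orthogonal_transformation_def inner_commute)
    moreover have "norm w' = norm a" using elim w' nf a by simp
    ultimately show ?case
      using haar_uniform_inner_rotate[OF \<mu> S(1) w'(1) a(1)] by simp
  qed
  also have "\<dots> = emeasure (distr \<mu> borel ((\<bullet>) a)) X"
    by (simp add: \<nu>.emeasure_space_1)
  finally show "emeasure (distr \<mu> borel ((\<bullet>) a)) X = emeasure (distr \<nu> borel ((\<bullet>) b)) X" ..
qed simp


lemma orthogonal_comp_singleton: "orthogonal_comp {u} = {x. u \<bullet> x = 0}"
  by (auto simp: orthogonal_comp_def orthogonal_def)

lemma orthogonal_transformation_image_orthogonal_comp: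
  fixes f :: "'a::euclidean_space \<Rightarrow> 'a"
  assumes "orthogonal_transformation f"
  shows "f ` orthogonal_comp {u} = orthogonal_comp {f u}"
proof -
  have "f x \<bullet> f y = x \<bullet> y" for x y using assms by (simp add: orthogonal_transformation_def)
  moreover have "surj f" using assms by (rule orthogonal_transformation_surj)
  ultimately show ?thesis
    unfolding orthogonal_comp_singleton by (auto simp: image_iff) (metis surjD)
qed

text \<open>
  The conditional law of \<open>T u \<bullet> V\<close> depends on \<open>u\<close> only through \<open>norm (T u)\<close>: the marginal in a unit
  direction may be computed in one reference hyperplane \<open>u'\<^sup>\<bottom>\<close>.
\<close>

lemma haar_uniform_inner_scale:
  fixes u u' :: "'a::euclidean_space"
  assumes \<mu>: "haar_uniform_on_unit_sphere (orthogonal_comp {u}) \<mu>"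
    and \<nu>: "haar_uniform_on_unit_sphere (orthogonal_comp {u'}) \<nu>"
    and u: "norm u = norm u'"
    and e: "e \<in> orthogonal_comp {u'}" "norm e = 1"
    and a: "a \<in> orthogonal_comp {u}"
    and X[measurable]: "X \<in> sets borel"
  shows "(\<integral>\<^sup>+v. indicator X (a \<bullet> v) \<partial>\<mu>) = (\<integral>\<^sup>+w. indicator X (norm a * w) \<partial>distr \<nu> borel ((\<bullet>) e))"
proof -
  note [measurable_cong] = haar_uniform_measurable_eq(1)[OF \<mu>] haar_uniform_measurable_eq(1)[OF \<nu>]
  obtain f where f: "orthogonal_transformation f" "f u' = u"
    using reflection_exchanging[of u' u] u by metis
  have im: "f ` orthogonal_comp {u'} = orthogonal_comp {u}"
    using orthogonal_transformation_image_orthogonal_comp[OF f(1)] f(2) by simp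
  \<comment> \<open>If \<open>a = 0\<close> any unit vector of the hyperplane serves as its direction;
    \<open>f e\<close> is one.\<close>
  define e' where "e' = (if a = 0 then f e else a /\<^sub>R norm a)"
  have "f e \<in> orthogonal_comp {u}" using im e by blast
  then have e': "e' \<in> orthogonal_comp {u}" "norm e' = 1"
    using a e orthogonal_transformation_norm[OF f(1)]
    by (auto simp: e'_def subspace_scale[OF subspace_orthogonal_comp])
  have "a = norm a *\<^sub>R e'" by (simp add: e'_def)
  then have "(\<integral>\<^sup>+v. indicator X (a \<bullet> v) \<partial>\<mu>) = (\<integral>\<^sup>+v. indicator X (norm a * (e' \<bullet> v)) \<partial>\<mu>)"
    by (metis inner_scaleR_left)
  also have "\<dots> = (\<integral>\<^sup>+w. indicator X (norm a * w) \<partial>distr \<mu> borel ((\<bullet>) e'))"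
    by (rule nn_integral_distr[symmetric]) measurable
  also have "distr \<mu> borel ((\<bullet>) e') = distr \<nu> borel ((\<bullet>) e)"
    by (rule haar_uniform_inner_unique[OF \<nu> \<mu> subspace_orthogonal_comp subspace_orthogonal_comp f(1) im e e', symmetric])
  finally show ?thesis .
qed

section \<open>The norm of a Gaussian vector\<close>

text \<open>
  By independence the characteristic function is the product of the factors \<open>exp (- t\<^sup>2 (c i)\<^sup>2 / 2)\<close>,
  and the squares of the coefficients add up to 1.
\<close>

lemma gaussian_unit_combination:
  assumes "finite I" "(\<Sum>i\<in>I. (c i)\<^sup>2) = 1"
  shows "distr (PiM I (\<lambda>_. std_normal_distribution)) borel (\<lambda>x. \<Sum>i\<in>I. c i * x i) = std_normal_distribution"
    (is "distr ?P borel ?s = _")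
proof (rule Levy_uniqueness)
  interpret N: real_distribution std_normal_distribution by (rule real_dist_normal_dist)
  interpret product_prob_space "\<lambda>_. std_normal_distribution" I ..
  have m[measurable]: "?s \<in> borel_measurable ?P" by measurable
  show "real_distribution (distr ?P borel ?s)"
    by (intro real_distribution_distr m)
  show "char (distr ?P borel ?s) = char std_normal_distribution"
  proof
    fix t
    have "char (distr ?P borel ?s) t = (\<integral>x. (\<Prod>i\<in>I. iexp (t * c i * x i)) \<partial>?P)"
      using assms(1)
      by (simp add: char_def integral_distr sum_distrib_left exp_sum[symmetric] mult.assoc)
    also have "\<dots> = (\<Prod>i\<in>I. (\<integral>y. iexp (t * c i * y) \<partial>std_normal_distribution))"
      by (rule product_integral_prod) (auto intro!: assms N.integrable_const_bound[where B=1])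
    also have "\<dots> = (\<Prod>i\<in>I. complex_of_real (exp (- (t * c i)\<^sup>2 / 2)))"
      by (simp only: char_def[symmetric] char_std_normal_distribution)
    also have "\<dots> = complex_of_real (exp (\<Sum>i\<in>I. - (t * c i)\<^sup>2 / 2))"
      using assms(1) by (simp add: exp_sum)
    also have "(\<Sum>i\<in>I. - (t * c i)\<^sup>2 / 2) = - (t\<^sup>2) / 2 * (\<Sum>i\<in>I. (c i)\<^sup>2)"
      by (simp add: sum_distrib_left power_mult_distrib)
    also have "complex_of_real (exp \<dots>) = char std_normal_distribution t"
      by (simp add: assms(2) char_std_normal_distribution)
    finally show "char (distr ?P borel ?s) t = char std_normal_distribution t" .
  qed
qed (rule real_dist_normal_dist)

text \<open>
  The chi distribution with \<open>card I\<close> degrees of freedom.  Its dimension is the size of a set and not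
  a type, because it will be the dimension of a hyperplane.
\<close>

definition chi_law :: "'i set \<Rightarrow> real measure"
  where "chi_law I = distr (PiM I (\<lambda>_. std_normal_distribution)) borel (\<lambda>x. sqrt (\<Sum>i\<in>I. (x i)\<^sup>2))"

lemma real_distribution_chi_law:
  assumes "finite I"
  shows "real_distribution (chi_law I)"
proof -
  interpret N: real_distribution std_normal_distribution by (rule real_dist_normal_dist)
  interpret product_prob_space "\<lambda>_. std_normal_distribution" I ..
  show ?thesis unfolding chi_law_def by (intro real_distribution_distr) measurable
qed

text \<open>
  Expanding in the orthonormal basis \<open>B\<close>, a standard Gaussian vector \<open>p x\<close> of \<open>S\<close> has norm \<open>r x\<close>.
  Let \<open>v\<close> be an independent vector with law \<open>\<mu>\<close>, and consider \<open>p x \<bullet> v\<close>.  Given \<open>x\<close> it is distributed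
  as \<open>r x * (e \<bullet> v)\<close> by rotation invariance of \<open>\<mu>\<close>; given \<open>v\<close> it is standard normal, as a Gaussian
  marginal in the unit direction \<open>v\<close>.
\<close>

lemma chi_law_mult_haar:
  fixes e :: "'a::euclidean_space"
  assumes \<mu>: "haar_uniform_on_unit_sphere S \<mu>" and S: "subspace S" "e \<in> S" "norm e = 1"
    and B: "pairwise orthogonal B" "\<And>x. x \<in> B \<Longrightarrow> norm x = 1" "independent B" "span B = S"
  shows "mult_conv (chi_law B) (distr \<mu> borel ((\<bullet>) e)) = std_normal_distribution"
proof (rule real_distribution_eqI)
  interpret \<mu>: prob_space \<mu> using haar_uniform_measurable_eq[OF \<mu>] by simp
  note [measurable_cong] = haar_uniform_measurable_eq(1)[OF \<mu>]
  interpret N: real_distribution std_normal_distribution by (rule real_dist_normal_dist)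
  interpret prd: product_prob_space "\<lambda>_. std_normal_distribution" B ..
  let ?P = "PiM B (\<lambda>_. std_normal_distribution)"
  interpret pair_sigma_finite ?P \<mu> ..
  have fin: "finite B" using B(3) by (rule independent_imp_finite)
  have rdc: "real_distribution (chi_law B)" by (rule real_distribution_chi_law[OF fin])
  have rde: "real_distribution (distr \<mu> borel ((\<bullet>) e))"
    by (intro \<mu>.real_distribution_distr) measurable
  show "real_distribution (mult_conv (chi_law B) (distr \<mu> borel ((\<bullet>) e)))"
    by (intro real_distribution_mult_conv rdc rde)
  show "real_distribution std_normal_distribution" by (rule real_dist_normal_dist)
  fix X :: "real set" assume [measurable]: "X \<in> sets borel"
  define r where "r x = sqrt (\<Sum>i\<in>B. (x i)\<^sup>2)" for x :: "'a \<Rightarrow> real"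
  define p where "p x = (\<Sum>i\<in>B. x i *\<^sub>R i)" for x :: "'a \<Rightarrow> real"
  have [measurable]: "r \<in> borel_measurable ?P" "p \<in> borel_measurable ?P"
    by (simp_all add: r_def[abs_def] p_def[abs_def])
  have norm_p: "norm (p x) = r x" for x
  proof -
    have "(norm (p x))\<^sup>2 = (\<Sum>i\<in>B. (norm (x i *\<^sub>R i))\<^sup>2)"
      unfolding p_def using B(1) fin by (intro norm_sum_Pythagorean) (auto simp: pairwise_def orthogonal_def)
    also have "\<dots> = (\<Sum>i\<in>B. (x i)\<^sup>2)" using B(2) by (intro sum.cong) (auto simp: power_mult_distrib)
    finally show ?thesis by (simp add: r_def real_sqrt_unique)
  qed
  have pS: "p x \<in> S" for x
    unfolding p_def B(4)[symmetric] by (intro span_sum span_scale span_base)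
  have "emeasure (mult_conv (chi_law B) (distr \<mu> borel ((\<bullet>) e))) X
      = (\<integral>\<^sup>+x. \<integral>\<^sup>+v. indicator X (r x * (e \<bullet> v)) \<partial>\<mu> \<partial>?P)"
    unfolding emeasure_mult_conv[OF rdc rde \<open>X \<in> sets borel\<close>]
    by (simp add: chi_law_def nn_integral_distr r_def)
  also have "\<dots> = (\<integral>\<^sup>+x. \<integral>\<^sup>+v. indicator X (p x \<bullet> v) \<partial>\<mu> \<partial>?P)"
  proof (rule nn_integral_cong)
    fix x
    have ind: "emeasure (distr \<mu> borel ((\<bullet>) c)) X = (\<integral>\<^sup>+v. indicator X (c \<bullet> v) \<partial>\<mu>)" for c
      by (rule emeasure_distr_eq_nn_integral) measurable
    have "norm (r x *\<^sub>R e) = norm (p x)" using S norm_p[of x] by (simp add: r_def sum_nonneg)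
    then have "distr \<mu> borel ((\<bullet>) (r x *\<^sub>R e)) = distr \<mu> borel ((\<bullet>) (p x))"
      using S pS by (intro haar_uniform_inner_rotate[OF \<mu>]) (auto simp: subspace_scale)
    then show "(\<integral>\<^sup>+v. indicator X (r x * (e \<bullet> v)) \<partial>\<mu>) = (\<integral>\<^sup>+v. indicator X (p x \<bullet> v) \<partial>\<mu>)"
      using ind[of "r x *\<^sub>R e"] ind[of "p x"] by simp
  qed
  also have "\<dots> = (\<integral>\<^sup>+v. \<integral>\<^sup>+x. indicator X (p x \<bullet> v) \<partial>?P \<partial>\<mu>)"
    by (subst Fubini') auto
  also have "\<dots> = (\<integral>\<^sup>+v. emeasure std_normal_distribution X \<partial>\<mu>)"
    using haar_uniform_AE_unit[OF \<mu> S(1)]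
  proof (intro nn_integral_cong_AE, eventually_elim)
    case (elim v)
    have "v = (\<Sum>i\<in>B. (v \<bullet> i) *\<^sub>R i)"
      using orthonormal_basis_expand[OF B(1,2) _ fin, of v] elim B(4) by simp
    then have "v \<bullet> v = v \<bullet> (\<Sum>i\<in>B. (v \<bullet> i) *\<^sub>R i)" by (rule arg_cong)
    also have "\<dots> = (\<Sum>i\<in>B. (v \<bullet> i) * (v \<bullet> i))" by (simp add: inner_sum_right)
    finally have "v \<bullet> v = (\<Sum>i\<in>B. (v \<bullet> i) * (v \<bullet> i))" .
    then have "(\<Sum>i\<in>B. (v \<bullet> i)\<^sup>2) = 1" using elim by (simp add: dot_square_norm power2_eq_square)
    note g = gaussian_unit_combination[OF fin this]
    have "emeasure std_normal_distribution X = (\<integral>\<^sup>+x. indicator X (\<Sum>i\<in>B. (v \<bullet> i) * x i) \<partial>?P)"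
      by (subst g[symmetric], rule emeasure_distr_eq_nn_integral) measurable
    moreover have "p x \<bullet> v = (\<Sum>i\<in>B. (v \<bullet> i) * x i)" for x
      unfolding p_def inner_sum_left by (intro sum.cong) (simp_all add: inner_commute)
    ultimately show ?case by presburger
  qed
  finally show "emeasure (mult_conv (chi_law B) (distr \<mu> borel ((\<bullet>) e))) X = emeasure std_normal_distribution X"
    by (simp add: \<mu>.emeasure_space_1)
qed

text \<open>
  Polar coordinates for radial functions: a ball of radius \<open>r\<close> has volume proportional to
  \<open>r ^ card I\<close>, and the radial density is the derivative of this volume.
\<close>

lemma distr_norm_PiM_lborel:
  fixes I :: "'i set"
  assumes I: "finite I" "I \<noteq> {}"
  shows "distr (PiM I (\<lambda>_. lborel)) borel (\<lambda>x. sqrt (\<Sum>i\<in>I. (x i)\<^sup>2))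
    = density lborel (\<lambda>r. ennreal (unit_ball_vol (card I) * (card I * r ^ (card I - 1))) * indicator {0..} r)"
    (is "distr ?P borel ?n = density lborel ?g")
proof (rule measure_eqI_generator_eq[where E = "range atMost" and \<Omega> = UNIV and A = "\<lambda>n. {..real n}"])
  interpret product_sigma_finite "\<lambda>_::'i. lborel :: real measure" ..
  define d where "d = card I"
  have d: "d > 0" using I by (simp add: d_def card_gt_0_iff)
  have m[measurable]: "?n \<in> borel_measurable ?P" by measurable
  have L: "emeasure (distr ?P borel ?n) {..r} = (if r \<le> 0 then 0 else ennreal (unit_ball_vol d * r ^ d))" for r
  proof -
    let ?D = "{f. sqrt (\<Sum>i\<in>I. (f i)\<^sup>2) \<le> r} \<inter> space ?P"
    have "emeasure (distr ?P borel ?n) {..r} = emeasure ?P (?n -` {..r} \<inter> space ?P)"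
      by (rule emeasure_distr) measurable
    also have "?n -` {..r} \<inter> space ?P = ?D" by auto
    finally have D: "emeasure (distr ?P borel ?n) {..r} = emeasure ?P ?D" .
    show ?thesis
    proof (cases "r > 0")
      case True
      then have "(if r \<le> 0 then 0 else ennreal (unit_ball_vol d * r ^ d)) = ennreal (unit_ball_vol (real (card I)) * r ^ card I)"
        by (simp add: d_def)
      then show ?thesis unfolding D emeasure_cball_aux[OF I(1) True] by (rule sym)
    next
      case False
      have "?D \<subseteq> (\<Pi>\<^sub>E i\<in>I. {0})"
      proof
        fix x assume x: "x \<in> ?D"
        then have "sqrt (\<Sum>i\<in>I. (x i)\<^sup>2) \<le> r" by simp
        with False have "sqrt (\<Sum>i\<in>I. (x i)\<^sup>2) \<le> 0" by linarith
        then have "(\<Sum>i\<in>I. (x i)\<^sup>2) \<le> 0" by (simp only: real_sqrt_le_0_iff)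
        then have "(\<Sum>i\<in>I. (x i)\<^sup>2) = 0" by (intro antisym sum_nonneg) auto
        then have "\<forall>i\<in>I. x i = 0" using I by (subst (asm) sum_nonneg_eq_0_iff) auto
        then show "x \<in> (\<Pi>\<^sub>E i\<in>I. {0})"
          using x by (intro PiE_I) (auto simp: space_PiM PiE_def extensional_def)
      qed
      then have "emeasure ?P ?D \<le> emeasure ?P (\<Pi>\<^sub>E i\<in>I. {0})"
        using I by (intro emeasure_mono sets_PiM_I_finite) auto
      also have "\<dots> = (\<Prod>i\<in>I. emeasure lborel {0::real})" using I by (intro emeasure_PiM) auto
      also have "\<dots> = 0" using I by (simp add: card_gt_0_iff)
      finally show ?thesis using False unfolding D by simp
    qed
  qed
  have R: "emeasure (density lborel ?g) {..r} = (if r \<le> 0 then 0 else ennreal (unit_ball_vol d * r ^ d))" for r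
  proof (cases "r > 0")
    case True
    have "emeasure (density lborel ?g) {..r}
        = (\<integral>\<^sup>+x. ennreal (unit_ball_vol d * (d * x ^ (d - 1))) * indicator {0..r} x \<partial>lborel)"
      by (subst emeasure_density) (auto intro!: nn_integral_cong simp: d_def split: split_indicator)
    also have "\<dots> = ennreal (unit_ball_vol d * r ^ d - unit_ball_vol d * 0 ^ d)"
      using True by (intro nn_integral_FTC_Icc) (auto intro!: derivative_eq_intros)
    finally show ?thesis using True d by (simp add: zero_power)
  next
    case False
    have "emeasure (density lborel ?g) {..r} = (\<integral>\<^sup>+x. ?g x * indicator {..r} x \<partial>lborel)"
      by (rule emeasure_density) measurable
    also have "\<dots> = (\<integral>\<^sup>+(x::real). 0 \<partial>lborel)"
    proof (rule nn_integral_cong_AE)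
      show "AE x in lborel. ?g x * indicator {..r} x = 0"
        using AE_lborel_singleton[of "0::real"]
        by eventually_elim (use False in \<open>auto split: split_indicator\<close>)
    qed
    finally have "emeasure (density lborel ?g) {..r} = (\<integral>\<^sup>+(x::real). 0 \<partial>lborel)" .
    then show ?thesis using False by simp
  qed
  show "emeasure (distr ?P borel ?n) X = emeasure (density lborel ?g) X" if "X \<in> range atMost" for X
    using that L R by auto
  show "emeasure (distr ?P borel ?n) {..real n} \<noteq> \<infinity>" for n by (simp add: L)
  show "(\<Union>n. {..real n}) = UNIV" by (auto simp: real_arch_simple)
  show "Int_stable (range (atMost :: real \<Rightarrow> _))" by (auto simp: Int_stable_def)
  have "sets (borel :: real measure) = sigma_sets UNIV (range atMost)"
    by (subst borel_eq_atMost) simp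
  then show "sets (distr ?P borel ?n) = sigma_sets UNIV (range atMost)"
    "sets (density lborel ?g) = sigma_sets UNIV (range atMost)" by simp_all
qed auto

text \<open>
  Both measures agree on boxes, where the integral of the product density factorizes.
\<close>

lemma PiM_density_lborel:
  fixes f :: "'i \<Rightarrow> real \<Rightarrow> ennreal"
  assumes I: "finite I" and f[measurable]: "\<And>i. f i \<in> borel_measurable borel"
    and p: "\<And>i. prob_space (density lborel (f i))"
  shows "PiM I (\<lambda>i. density lborel (f i)) = density (PiM I (\<lambda>_. lborel)) (\<lambda>x. \<Prod>i\<in>I. f i (x i))"
proof -
  interpret prob_space "density lborel (f i)" for i by (rule p)
  interpret D: product_sigma_finite "\<lambda>i. density lborel (f i)" ..
  interpret L: product_sigma_finite "\<lambda>_::'i. lborel :: real measure" ..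
  have s: "sets (PiM I (\<lambda>i. density lborel (f i))) = sets (PiM I (\<lambda>_. lborel))"
    by (intro sets_PiM_cong) auto
  show ?thesis
  proof (rule D.PiM_eqI[OF I, symmetric])
    show "sets (density (PiM I (\<lambda>_. lborel)) (\<lambda>x. \<Prod>i\<in>I. f i (x i))) = sets (PiM I (\<lambda>i. density lborel (f i)))"
      by (simp add: s)
    fix A assume A: "\<And>i. i \<in> I \<Longrightarrow> A i \<in> sets (density lborel (f i))"
    then have [measurable]: "\<And>i. i \<in> I \<Longrightarrow> A i \<in> sets borel" by simp
    have "emeasure (density (PiM I (\<lambda>_. lborel)) (\<lambda>x. \<Prod>i\<in>I. f i (x i))) (Pi\<^sub>E I A)
        = (\<integral>\<^sup>+x. (\<Prod>i\<in>I. f i (x i)) * indicator (Pi\<^sub>E I A) x \<partial>PiM I (\<lambda>_. lborel))"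
      using I A by (intro emeasure_density sets_PiM_I_finite) auto
    also have "\<dots> = (\<integral>\<^sup>+x. (\<Prod>i\<in>I. f i (x i) * indicator (A i) (x i)) \<partial>PiM I (\<lambda>_. lborel))"
    proof (rule nn_integral_cong)
      fix x assume "x \<in> space (PiM I (\<lambda>_. lborel :: real measure))"
      then have "indicator (Pi\<^sub>E I A) x = (\<Prod>i\<in>I. indicator (A i) (x i) :: ennreal)"
        using I by (auto simp: indicator_def space_PiM PiE_iff prod_zero_iff)
      then show "(\<Prod>i\<in>I. f i (x i)) * indicator (Pi\<^sub>E I A) x = (\<Prod>i\<in>I. f i (x i) * indicator (A i) (x i))"
        by (simp add: prod.distrib)
    qed
    also have "\<dots> = (\<Prod>i\<in>I. \<integral>\<^sup>+y. f i y * indicator (A i) y \<partial>lborel)"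
      using I by (intro L.product_nn_integral_prod) auto
    also have "\<dots> = (\<Prod>i\<in>I. emeasure (density lborel (f i)) (A i))"
      using A by (intro prod.cong refl) (simp add: emeasure_density)
    finally show "emeasure (density (PiM I (\<lambda>_. lborel)) (\<lambda>x. \<Prod>i\<in>I. f i (x i))) (Pi\<^sub>E I A)
        = (\<Prod>i\<in>I. emeasure (density lborel (f i)) (A i))" .
  qed
qed

text \<open>
  The Gaussian density is a function of the norm alone, so only the radial part of Lebesgue measure
  matters.  The value of the constant is left open: normalization fixes it whenever it is needed.
\<close>

lemma chi_law_density:
  fixes I :: "'i set"
  assumes I: "finite I" "I \<noteq> {}"
  obtains c where "chi_law I = density lborel
    (\<lambda>s. c * ennreal (indicator {0..} s * s ^ (card I - 1) * exp (- s\<^sup>2 / 2)))"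
proof -
  define n where "n x = sqrt (\<Sum>i\<in>I. (x i)\<^sup>2)" for x :: "'i \<Rightarrow> real"
  define K where "K = (1 / sqrt (2 * pi)) ^ card I"
  define V where "V = unit_ball_vol (card I) * card I"
  let ?L = "PiM I (\<lambda>_::'i. lborel :: real measure)"
  let ?N = "PiM I (\<lambda>_::'i. std_normal_distribution)"
  let ?q = "\<lambda>r::real. ennreal (unit_ball_vol (card I) * (card I * r ^ (card I - 1))) * indicator {0..} r"
  have [measurable]: "n \<in> borel_measurable ?L" unfolding n_def by measurable
  have K: "K \<ge> 0" by (simp add: K_def)
  have V: "V \<ge> 0" by (simp add: V_def)
  have N: "?N = density ?L (\<lambda>x. ennreal (K * exp (- (n x)\<^sup>2 / 2)))"
  proof -
    have "?N = density ?L (\<lambda>x. \<Prod>i\<in>I. ennreal (std_normal_density (x i)))"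
      by (rule PiM_density_lborel[OF I(1)]) (auto intro: prob_space_normal_density)
    also have "(\<lambda>x. \<Prod>i\<in>I. ennreal (std_normal_density (x i))) = (\<lambda>x. ennreal (K * exp (- (n x)\<^sup>2 / 2)))"
    proof
      fix x :: "'i \<Rightarrow> real"
      have "(\<Prod>i\<in>I. std_normal_density (x i)) = K * exp (\<Sum>i\<in>I. - (x i)\<^sup>2 / 2)"
        using I by (simp only: std_normal_density_def prod.distrib prod_constant exp_sum K_def)
      also have "(\<Sum>i\<in>I. - (x i)\<^sup>2 / 2) = - (n x)\<^sup>2 / 2"
        by (simp add: n_def sum_nonneg sum_negf sum_divide_distrib)
      finally show "(\<Prod>i\<in>I. ennreal (std_normal_density (x i))) = ennreal (K * exp (- (n x)\<^sup>2 / 2))"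
        by (subst prod_ennreal) auto
    qed
    finally show ?thesis .
  qed
  have "chi_law I = density lborel (\<lambda>s. ennreal (V * K) * ennreal (indicator {0..} s * s ^ (card I - 1) * exp (- s\<^sup>2 / 2)))"
    (is "_ = density lborel ?h")
  proof (rule measure_eqI)
    show "sets (chi_law I) = sets (density lborel ?h)" by (simp add: chi_law_def)
    fix X assume "X \<in> sets (chi_law I)"
    then have X[measurable]: "X \<in> sets borel" by (simp add: chi_law_def)
    have "emeasure (chi_law I) X = (\<integral>\<^sup>+x. indicator X (n x) \<partial>?N)"
      unfolding chi_law_def by (subst emeasure_distr_eq_nn_integral) (auto simp: n_def)
    also have "\<dots> = (\<integral>\<^sup>+x. ennreal (K * exp (- (n x)\<^sup>2 / 2)) * indicator X (n x) \<partial>?L)"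
      unfolding N by (rule nn_integral_density) measurable
    also have "\<dots> = (\<integral>\<^sup>+r. ennreal (K * exp (- r\<^sup>2 / 2)) * indicator X r \<partial>distr ?L borel n)"
      by (rule nn_integral_distr[symmetric]) measurable
    also have "distr ?L borel n = density lborel ?q"
      unfolding n_def by (rule distr_norm_PiM_lborel[OF I])
    also have "(\<integral>\<^sup>+r. ennreal (K * exp (- r\<^sup>2 / 2)) * indicator X r \<partial>density lborel ?q)
        = (\<integral>\<^sup>+r. ?q r * (ennreal (K * exp (- r\<^sup>2 / 2)) * indicator X r) \<partial>lborel)"
      by (rule nn_integral_density) measurable
    also have "\<dots> = (\<integral>\<^sup>+r. ?h r * indicator X r \<partial>lborel)"
      using K V by (intro nn_integral_cong)
        (auto simp: V_def ennreal_mult[symmetric] mult_ac split: split_indicator)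
    also have "\<dots> = emeasure (density lborel ?h) X"
      by (rule emeasure_density[symmetric]) measurable
    finally show "emeasure (chi_law I) X = emeasure (density lborel ?h) X" .
  qed
  then show ?thesis by (rule that)
qed

section \<open>Ratios with a Gaussian denominator\<close>

text \<open>
  A density known up to a factor is identified by its total mass.  The constants of the ratio laws below
  are found in this way.
\<close>

lemma prob_density_scalar_unique:
  assumes [measurable]: "f \<in> borel_measurable M"
    and "prob_space (density M (\<lambda>x. c * f x))" "prob_space (density M (\<lambda>x. c' * f x))"
  shows "c = c'"
proof -
  define I where "I = (\<integral>\<^sup>+x. f x \<partial>M)"
  have "b * I = 1" if "prob_space (density M (\<lambda>x. b * f x))" for b
    using prob_space.emeasure_space_1[OF that] by (simp add: emeasure_density nn_integral_cmult I_def)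
  with assms have "c * I = 1" "c' * I = 1" by blast+
  have "c = c * (c' * I)" unfolding \<open>c' * I = 1\<close> by simp
  also have "\<dots> = c' * (c * I)" by (rule mult.left_commute)
  also have "\<dots> = c'" unfolding \<open>c * I = 1\<close> by simp
  finally show ?thesis .
qed


definition inv_abs_normal :: "real measure"
  where "inv_abs_normal = distr std_normal_distribution borel (\<lambda>y. 1 / \<bar>y\<bar>)"

lemma real_distribution_inv_abs_normal: "real_distribution inv_abs_normal"
proof -
  interpret N: real_distribution std_normal_distribution by (rule real_dist_normal_dist)
  show ?thesis unfolding inv_abs_normal_def by (intro N.real_distribution_distr) measurable
qed

text \<open>
  Let \<open>A\<close> be the law of \<open>s\<close> with density proportional to \<open>w s * exp (- s\<^sup>2 / 2)\<close>, where \<open>w\<close> is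
  homogeneous of degree \<open>k\<close>.  Substituting \<open>s = \<bar>y\<bar> r\<close> gives the joint density of \<open>r = s / \<bar>y\<bar>\<close>
  and \<open>y\<close>, proportional to \<open>w r * \<bar>y\<bar> ^ (k + 1) * exp (- y\<^sup>2 (1 + r\<^sup>2) / 2)\<close>; rescaling \<open>y\<close> by
  \<open>sqrt (1 + r\<^sup>2)\<close> then integrates it out.  The case \<open>w = 1\<close> yields the Cauchy law, and
  \<open>w s = s ^ (d - 1)\<close> on the half-line yields the ratio whose square is beta prime distributed.
\<close>

lemma mult_conv_inv_abs_normal:
  fixes w :: "real \<Rightarrow> real" and k :: nat
  assumes A: "real_distribution A" "A = density lborel (\<lambda>s. c * ennreal (w s * exp (- s\<^sup>2 / 2)))"
    and w[measurable]: "w \<in> borel_measurable borel" and w0: "\<And>s. 0 \<le> w s"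
    and hom: "\<And>r y. 0 < y \<Longrightarrow> w (y * r) = y ^ k * w r"
  obtains c' where "mult_conv A inv_abs_normal
      = density lborel (\<lambda>r. c' * ennreal (w r / sqrt (1 + r\<^sup>2) ^ (k + 2)))"
proof -
  interpret A: real_distribution A by (rule A(1))
  let ?a = "\<lambda>r::real. sqrt (1 + r\<^sup>2)"
  let ?\<phi> = std_normal_density
  define J where "J = (\<integral>\<^sup>+y. ennreal (\<bar>y\<bar> ^ (k + 1) * ?\<phi> y) \<partial>lborel)"
  let ?h = "\<lambda>r. c * J * ennreal (w r / ?a r ^ (k + 2))"
  have "mult_conv A inv_abs_normal = density lborel ?h"
  proof (rule measure_eqI)
    fix X assume "X \<in> sets (mult_conv A inv_abs_normal)"
    then have X[measurable]: "X \<in> sets borel" by (simp add: mult_conv_def)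
    have scale_s: "(\<integral>\<^sup>+s. indicator X (1 / \<bar>y\<bar> * s) \<partial>A)
        = (\<integral>\<^sup>+r. c * ennreal (\<bar>y\<bar> ^ (k + 1) * w r * exp (- (y * r)\<^sup>2 / 2)) * indicator X r \<partial>lborel)"
      if y: "y \<noteq> 0" for y
    proof -
      have "(\<integral>\<^sup>+s. indicator X (1 / \<bar>y\<bar> * s) \<partial>A)
          = (\<integral>\<^sup>+s. c * ennreal (w s * exp (- s\<^sup>2 / 2)) * indicator X (1 / \<bar>y\<bar> * s) \<partial>lborel)"
        unfolding A(2) by (rule nn_integral_density) measurable
      also have "\<dots> = ennreal \<bar>y\<bar> * (\<integral>\<^sup>+r. c * ennreal (w (\<bar>y\<bar> * r) * exp (- (\<bar>y\<bar> * r)\<^sup>2 / 2)) * indicator X r \<partial>lborel)"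
        using y by (subst nn_integral_real_affine[where c = "\<bar>y\<bar>" and t = 0]) auto
      also have "\<dots> = (\<integral>\<^sup>+r. ennreal \<bar>y\<bar> * (c * ennreal (w (\<bar>y\<bar> * r) * exp (- (\<bar>y\<bar> * r)\<^sup>2 / 2)) * indicator X r) \<partial>lborel)"
        by (rule nn_integral_cmult[symmetric]) measurable
      also have "\<dots> = (\<integral>\<^sup>+r. c * ennreal (\<bar>y\<bar> ^ (k + 1) * w r * exp (- (y * r)\<^sup>2 / 2)) * indicator X r \<partial>lborel)"
      proof (rule nn_integral_cong)
        fix r
        have "ennreal (\<bar>y\<bar> ^ (k + 1) * w r * exp (- (y * r)\<^sup>2 / 2))
            = ennreal \<bar>y\<bar> * ennreal (w (\<bar>y\<bar> * r) * exp (- (\<bar>y\<bar> * r)\<^sup>2 / 2))"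
          using y w0 hom[of "\<bar>y\<bar>" r] by (subst ennreal_mult[symmetric]) (auto simp: power_mult_distrib mult_ac)
        then show "ennreal \<bar>y\<bar> * (c * ennreal (w (\<bar>y\<bar> * r) * exp (- (\<bar>y\<bar> * r)\<^sup>2 / 2)) * indicator X r)
            = c * ennreal (\<bar>y\<bar> ^ (k + 1) * w r * exp (- (y * r)\<^sup>2 / 2)) * indicator X r"
          by (simp only: mult_ac)
      qed
      finally show ?thesis .
    qed
    have scale_y: "(\<integral>\<^sup>+y. ennreal (\<bar>y\<bar> ^ (k + 1) * exp (- (y * r)\<^sup>2 / 2) * ?\<phi> y) \<partial>lborel)
        = ennreal (1 / ?a r ^ (k + 2)) * J" for r
    proof -
      have a: "?a r > 0" "(?a r)\<^sup>2 = 1 + r\<^sup>2" by (auto simp: add_pos_nonneg)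
      have "J = ennreal (?a r) * (\<integral>\<^sup>+y. ennreal (\<bar>?a r * y\<bar> ^ (k + 1) * ?\<phi> (?a r * y)) \<partial>lborel)"
        unfolding J_def using a by (subst nn_integral_real_affine[where c = "?a r" and t = 0]) auto
      also have "(\<integral>\<^sup>+y. ennreal (\<bar>?a r * y\<bar> ^ (k + 1) * ?\<phi> (?a r * y)) \<partial>lborel)
          = (\<integral>\<^sup>+y. ennreal (?a r ^ (k + 1)) * ennreal (\<bar>y\<bar> ^ (k + 1) * exp (- (y * r)\<^sup>2 / 2) * ?\<phi> y) \<partial>lborel)"
      proof (rule nn_integral_cong)
        fix y
        have "?\<phi> (?a r * y) = exp (- (y * r)\<^sup>2 / 2) * ?\<phi> y"
        proof -
          have "(?a r * y)\<^sup>2 = (y * r)\<^sup>2 + y\<^sup>2"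
            unfolding power_mult_distrib a(2) by (simp add: algebra_simps)
          then have "- (?a r * y)\<^sup>2 / 2 = - (y * r)\<^sup>2 / 2 + - y\<^sup>2 / 2" by simp
          then show ?thesis unfolding std_normal_density_def by (simp only: exp_add mult_ac)
        qed
        then have "\<bar>?a r * y\<bar> ^ (k + 1) * ?\<phi> (?a r * y)
            = ?a r ^ (k + 1) * (\<bar>y\<bar> ^ (k + 1) * exp (- (y * r)\<^sup>2 / 2) * ?\<phi> y)"
          using a(1) by (simp only: abs_mult power_mult_distrib abs_of_pos mult_ac)
        then show "ennreal (\<bar>?a r * y\<bar> ^ (k + 1) * ?\<phi> (?a r * y))
            = ennreal (?a r ^ (k + 1)) * ennreal (\<bar>y\<bar> ^ (k + 1) * exp (- (y * r)\<^sup>2 / 2) * ?\<phi> y)"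
          by (simp only:) (intro ennreal_mult, auto)
      qed
      also have "\<dots> = ennreal (?a r ^ (k + 1)) * (\<integral>\<^sup>+y. ennreal (\<bar>y\<bar> ^ (k + 1) * exp (- (y * r)\<^sup>2 / 2) * ?\<phi> y) \<partial>lborel)"
        by (rule nn_integral_cmult) measurable
      finally have "J = ennreal (?a r ^ (k + 2)) * (\<integral>\<^sup>+y. ennreal (\<bar>y\<bar> ^ (k + 1) * exp (- (y * r)\<^sup>2 / 2) * ?\<phi> y) \<partial>lborel)"
        using a(1) by (simp add: mult.assoc[symmetric] ennreal_mult[symmetric] del: real_sqrt_power)
      then have "ennreal (1 / ?a r ^ (k + 2)) * J = ennreal (1 / ?a r ^ (k + 2) * ?a r ^ (k + 2))
          * (\<integral>\<^sup>+y. ennreal (\<bar>y\<bar> ^ (k + 1) * exp (- (y * r)\<^sup>2 / 2) * ?\<phi> y) \<partial>lborel)"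
        using a(1) by (simp only: mult.assoc[symmetric]) (subst ennreal_mult, auto)
      also have "1 / ?a r ^ (k + 2) * ?a r ^ (k + 2) = 1" using a(1) by simp
      finally show ?thesis by simp
    qed
    have "emeasure (mult_conv A inv_abs_normal) X = emeasure (mult_conv inv_abs_normal A) X"
      using mult_conv_commute[OF A(1) real_distribution_inv_abs_normal] by simp
    also have "\<dots> = (\<integral>\<^sup>+x. \<integral>\<^sup>+s. indicator X (x * s) \<partial>A \<partial>inv_abs_normal)"
      by (rule emeasure_mult_conv[OF real_distribution_inv_abs_normal A(1) X])
    also have "\<dots> = (\<integral>\<^sup>+y. \<integral>\<^sup>+s. indicator X (1 / \<bar>y\<bar> * s) \<partial>A \<partial>std_normal_distribution)"
      unfolding inv_abs_normal_def by (rule nn_integral_distr) measurable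
    also have "\<dots> = (\<integral>\<^sup>+y. ennreal (?\<phi> y) * (\<integral>\<^sup>+s. indicator X (1 / \<bar>y\<bar> * s) \<partial>A) \<partial>lborel)"
      by (rule nn_integral_density) measurable
    also have "\<dots> = (\<integral>\<^sup>+y. ennreal (?\<phi> y) * (\<integral>\<^sup>+r. c * ennreal (\<bar>y\<bar> ^ (k + 1) * w r * exp (- (y * r)\<^sup>2 / 2)) * indicator X r \<partial>lborel) \<partial>lborel)"
      using AE_lborel_singleton[of "0::real"]
      by (intro nn_integral_cong_AE, eventually_elim) (subst scale_s, simp_all)
    also have "\<dots> = (\<integral>\<^sup>+y. \<integral>\<^sup>+r. ennreal (?\<phi> y) * (c * ennreal (\<bar>y\<bar> ^ (k + 1) * w r * exp (- (y * r)\<^sup>2 / 2)) * indicator X r) \<partial>lborel \<partial>lborel)"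
      by (intro nn_integral_cong nn_integral_cmult[symmetric]) measurable
    also have "\<dots> = (\<integral>\<^sup>+r. \<integral>\<^sup>+y. ennreal (?\<phi> y) * (c * ennreal (\<bar>y\<bar> ^ (k + 1) * w r * exp (- (y * r)\<^sup>2 / 2)) * indicator X r) \<partial>lborel \<partial>lborel)"
      by (rule lborel_pair.Fubini') measurable
    also have "\<dots> = (\<integral>\<^sup>+r. \<integral>\<^sup>+y. (c * ennreal (w r) * indicator X r) * ennreal (\<bar>y\<bar> ^ (k + 1) * exp (- (y * r)\<^sup>2 / 2) * ?\<phi> y) \<partial>lborel \<partial>lborel)"
    proof (intro nn_integral_cong)
      fix r y
      let ?E = "ennreal (\<bar>y\<bar> ^ (k + 1) * w r * exp (- (y * r)\<^sup>2 / 2))"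
      let ?F = "ennreal (\<bar>y\<bar> ^ (k + 1) * exp (- (y * r)\<^sup>2 / 2) * ?\<phi> y)"
      have *: "ennreal (?\<phi> y) * ?E = ennreal (w r) * ?F"
        using w0[of r] by (subst (1 2) ennreal_mult[symmetric]) (auto simp: mult_ac)
      have "ennreal (?\<phi> y) * (c * ?E * indicator X r) = c * indicator X r * (ennreal (?\<phi> y) * ?E)"
        by (simp only: mult_ac)
      also have "\<dots> = (c * ennreal (w r) * indicator X r) * ?F"
        unfolding * by (simp only: mult_ac)
      finally show "ennreal (?\<phi> y) * (c * ?E * indicator X r) = (c * ennreal (w r) * indicator X r) * ?F" .
    qed
    also have "\<dots> = (\<integral>\<^sup>+r. (c * ennreal (w r) * indicator X r) * (ennreal (1 / ?a r ^ (k + 2)) * J) \<partial>lborel)"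
      by (intro nn_integral_cong, subst nn_integral_cmult) (measurable, simp only: scale_y)
    also have "\<dots> = (\<integral>\<^sup>+r. ?h r * indicator X r \<partial>lborel)"
    proof (intro nn_integral_cong)
      fix r
      have "ennreal (w r / ?a r ^ (k + 2)) = ennreal (w r) * ennreal (1 / ?a r ^ (k + 2))"
        using w0[of r] by (subst ennreal_mult[symmetric]) auto
      then show "(c * ennreal (w r) * indicator X r) * (ennreal (1 / ?a r ^ (k + 2)) * J) = ?h r * indicator X r"
        by (simp only: mult_ac)
    qed
    also have "\<dots> = emeasure (density lborel ?h) X"
      by (rule emeasure_density[symmetric]) measurable
    finally show "emeasure (mult_conv A inv_abs_normal) X = emeasure (density lborel ?h) X" .
  qed (simp add: mult_conv_def)
  then show ?thesis by (rule that)
qed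

section \<open>The Cauchy and beta laws as ratios\<close>

lemma prob_space_cauchy_density: "prob_space (density lborel (\<lambda>x. ennreal (cauchy_density 0 1 x)))"
proof (rule prob_spaceI)
  have i: "integrable lborel (\<lambda>x::real. inverse (1 + x\<^sup>2))"
    using integrable_inverse_1_plus_square by (simp add: set_integrable_def einterval_def)
  have "(LBINT x. inverse (1 + x\<^sup>2)) = pi"
    using LBINT_inverse_1_plus_square
    by (simp add: interval_lebesgue_integral_def set_lebesgue_integral_def einterval_def)
  then have nn: "(\<integral>\<^sup>+x. ennreal (inverse (1 + x\<^sup>2)) \<partial>lborel) = ennreal pi"
    using i by (subst nn_integral_eq_integral) auto
  have "(\<integral>\<^sup>+x. ennreal (cauchy_density 0 1 x) \<partial>lborel)
      = (\<integral>\<^sup>+x. ennreal (1 / pi) * ennreal (inverse (1 + x\<^sup>2)) \<partial>lborel)"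
    by (intro nn_integral_cong) (simp add: cauchy_density_def ennreal_mult[symmetric] divide_inverse mult.commute)
  also have "\<dots> = ennreal (1 / pi) * ennreal pi"
    by (subst nn_integral_cmult) (simp_all add: nn)
  also have "\<dots> = 1" by (simp add: ennreal_mult[symmetric])
  finally show "emeasure (density lborel (\<lambda>x. ennreal (cauchy_density 0 1 x)))
      (space (density lborel (\<lambda>x. ennreal (cauchy_density 0 1 x)))) = 1"
    by (simp add: emeasure_density cauchy_density_def[abs_def])
qed

lemma std_normal_ratio_cauchy:
  "mult_conv std_normal_distribution inv_abs_normal = density lborel (\<lambda>x. ennreal (cauchy_density 0 1 x))"
proof -
  have "std_normal_distribution
      = density lborel (\<lambda>s. ennreal (1 / sqrt (2 * pi)) * ennreal (1 * exp (- s\<^sup>2 / 2)))"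
    by (intro density_cong) (auto simp: std_normal_density_def ennreal_mult[symmetric])
  then obtain c where c: "mult_conv std_normal_distribution inv_abs_normal
      = density lborel (\<lambda>r. c * ennreal (1 / sqrt (1 + r\<^sup>2) ^ (0 + 2)))"
    by (rule mult_conv_inv_abs_normal[OF real_dist_normal_dist, where w = "\<lambda>_. 1" and k = 0]) auto
  have e: "(\<lambda>x. ennreal (cauchy_density 0 1 x))
      = (\<lambda>x. ennreal (1 / pi) * ennreal (1 / sqrt (1 + x\<^sup>2) ^ (0 + 2)))"
    by (auto simp: cauchy_density_def ennreal_mult[symmetric])
  have "prob_space (mult_conv std_normal_distribution inv_abs_normal)"
    using real_distribution_mult_conv[OF real_dist_normal_dist real_distribution_inv_abs_normal]
    by (simp add: real_distribution_def)
  then have "c = ennreal (1 / pi)"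
    using prob_space_cauchy_density unfolding c e
    by (intro prob_density_scalar_unique[where f = "\<lambda>r. ennreal (1 / sqrt (1 + r\<^sup>2) ^ (0 + 2))" and M = lborel]) auto
  then show ?thesis unfolding c e by simp
qed

lemma prob_space_beta_density:
  assumes "a > 0" "b > 0"
  shows "prob_space (density lborel (\<lambda>x. ennreal (beta_density a b x)))"
proof (rule prob_spaceI)
  have B: "Beta a b > 0" using assms by (simp add: Beta_def Gamma_real_pos)
  have I: "((\<lambda>t. t powr (a - 1) * (1 - t) powr (b - 1)) has_integral Beta a b) {0<..<1}"
    using has_integral_Beta_real[OF assms] by (simp add: has_integral_Icc_iff_Ioo)
  have "(\<integral>\<^sup>+x. ennreal (beta_density a b x) \<partial>lborel)
      = (\<integral>\<^sup>+x. ennreal (1 / Beta a b) * (ennreal (x powr (a - 1) * (1 - x) powr (b - 1)) * indicator {0<..<1} x) \<partial>lborel)"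
    using B by (intro nn_integral_cong)
      (auto simp: beta_density_def ennreal_mult[symmetric] split: split_indicator)
  also have "\<dots> = ennreal (1 / Beta a b) * ennreal (Beta a b)"
    by (subst nn_integral_cmult) (use nn_integral_has_integral_lebesgue'[OF _ I] in auto)
  also have "\<dots> = 1" using B by (simp add: ennreal_mult[symmetric])
  finally show "emeasure (density lborel (\<lambda>x. ennreal (beta_density a b x)))
      (space (density lborel (\<lambda>x. ennreal (beta_density a b x)))) = 1"
    by (simp add: emeasure_density beta_density_def[abs_def])
qed

text \<open>
  The beta kernel at \<open>x = 1 / a\<^sup>2\<close> times the Jacobian of \<open>r \<mapsto> 1 / (1 + r\<^sup>2)\<close>, where
  \<open>a = sqrt (1 + r\<^sup>2)\<close>; here \<open>1 - x = (r / a)\<^sup>2\<close>.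
\<close>

lemma beta_kernel_jacobian:
  fixes a r :: real and d :: nat
  assumes r: "r > 0" and a: "a > 0" "a\<^sup>2 = 1 + r\<^sup>2" and d: "d > 0"
  shows "2 * r / (a\<^sup>2)\<^sup>2 * ((1 / a\<^sup>2) powr (1/2 - 1) * (1 - 1 / a\<^sup>2) powr (real d / 2 - 1))
    = 2 * (r ^ (d - 1) / a ^ (d + 1))"
proof -
  have "1 / a\<^sup>2 = a powr (- 2)"
    using a(1) by (simp add: powr_minus_divide powr_numeral)
  then have 1: "(1 / a\<^sup>2) powr (1/2 - 1) = a"
    using a(1) by (simp add: powr_powr)
  have "1 - 1 / a\<^sup>2 = (a\<^sup>2 - 1) / a\<^sup>2"
    using a(1) by (simp add: diff_divide_distrib)
  also have "\<dots> = r\<^sup>2 / a\<^sup>2" by (simp add: a(2))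
  also have "\<dots> = (r / a) powr 2"
    using r a(1) by (simp add: powr_numeral power_divide)
  finally have "(1 - 1 / a\<^sup>2) powr (real d / 2 - 1) = (r / a) powr (2 * (real d / 2 - 1))"
    by (simp only: powr_powr)
  also have "2 * (real d / 2 - 1) = real (d - 1) - 1"
    using d by (simp add: of_nat_diff)
  also have "(r / a) powr \<dots> = (r / a) ^ (d - 1) / (r / a)"
    using r a(1) by (simp add: powr_diff powr_realpow)
  finally have 2: "(1 - 1 / a\<^sup>2) powr (real d / 2 - 1) = (r / a) ^ (d - 1) / (r / a)" .
  have "a ^ (d + 1) = a ^ (d - 1) * a\<^sup>2"
    using d by (simp add: power_add[symmetric])
  then show ?thesis
    unfolding 1 2 using r a(1) by (simp add: power_divide field_simps power2_eq_square)
qed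

text \<open>
  The substitution \<open>x = 1 / (1 + r\<^sup>2)\<close>, which maps the half-line \<open>r > 0\<close> decreasingly onto the unit
  interval.  The 2 in the constant comes from \<open>\<bar>dx/dr\<bar> = 2 r / (1 + r\<^sup>2)\<^sup>2\<close>, and the value of Beta
  undoes the normalization of the density.
\<close>

lemma nn_integral_beta_substitution:
  fixes X :: "real set" and d :: nat
  assumes d: "d > 0" and X[measurable]: "X \<in> sets borel"
  shows "(\<integral>\<^sup>+r. ennreal (indicator {0..} r * r ^ (d - 1) / sqrt (1 + r\<^sup>2) ^ (d + 1)) * indicator X (1 / (1 + r\<^sup>2)) \<partial>lborel)
    = (\<integral>\<^sup>+x. ennreal (Beta (1/2) (real d / 2) / 2) * ennreal (beta_density (1/2) (real d / 2) x) * indicator X x \<partial>lborel)"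
proof -
  define g where "g x = x powr (1/2 - 1) * (1 - x) powr (real d / 2 - 1)" for x :: real
  define f where "f x = indicator X x * g x" for x
  define h where "h r = 1 / (1 + r\<^sup>2)" for r :: real
  define h' where "h' r = - (2 * r) / (1 + r\<^sup>2)\<^sup>2" for r :: real
  define S where "S = {0::real<..}"
  have pos: "1 + r\<^sup>2 > 0" "1 + r\<^sup>2 \<noteq> 0" for r :: real
    by (auto simp: add_pos_nonneg add_nonneg_eq_0_iff)
  have B: "Beta (1/2) (real d / 2) > 0" using d by (simp add: Beta_def Gamma_real_pos)
  have [measurable]: "g \<in> borel_measurable borel" "f \<in> borel_measurable borel"
    by (simp_all add: g_def[abs_def] f_def[abs_def])
  have gI: "(g has_integral Beta (1/2) (real d / 2)) {0<..<1}"
    using has_integral_Beta_real[of "1/2" "real d / 2"] d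
    by (simp add: has_integral_Icc_iff_Ioo g_def[abs_def])
  have image: "h ` S = {0<..<1}"
  proof (intro equalityI subsetI)
    fix x assume x: "x \<in> {0<..<1::real}"
    then have "x = h (sqrt (1 / x - 1))" "sqrt (1 / x - 1) \<in> S"
      by (auto simp: h_def S_def field_simps)
    then show "x \<in> h ` S" by blast
  qed (auto simp: h_def S_def pos field_simps)
  have "g absolutely_integrable_on {0<..<1}"
    using gI by (intro nonnegative_absolutely_integrable_1) (auto simp: g_def integrable_on_def)
  then have fA: "f absolutely_integrable_on {0<..<1}"
    unfolding set_integrable_def
    by (rule Bochner_Integration.integrable_bound)
       (auto simp: f_def split: split_indicator intro!: measurable_completion)
  define b where "b = integral {0<..<1} f"
  have "(\<lambda>r. \<bar>h' r\<bar> * f (h r)) absolutely_integrable_on S \<and> integral S (\<lambda>r. \<bar>h' r\<bar> * f (h r)) = b"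
  proof (subst has_absolute_integral_change_of_variables_1'[where g = h and g' = h' and f = f])
    show "(h has_field_derivative h' x) (at x within S)" if "x \<in> S" for x
      unfolding h_def h'_def using pos[of x]
      by (auto intro!: derivative_eq_intros simp: power2_eq_square)
    show "inj_on h S"
      by (auto simp: inj_on_def h_def S_def pos)
  qed (use fA in \<open>auto simp: image[unfolded S_def] b_def S_def\<close>)
  then have hI: "((\<lambda>r. \<bar>h' r\<bar> * f (h r)) has_integral b) S"
    using absolutely_integrable_on_def has_integral_integrable_integral by blast
  have fI: "(f has_integral b) {0<..<1}"
    using fA absolutely_integrable_on_def has_integral_integrable_integral b_def by blast
  have f0: "f x \<ge> 0" for x by (simp add: f_def g_def)
  \<comment> \<open>The two sides may differ at \<open>r = 0\<close>, which \<open>S\<close> omits: for \<open>d = 1\<close> the density on the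
    right does not vanish there.\<close>
  have E: "ennreal (\<bar>h' r\<bar> * f (h r)) * indicator S r
      = 2 * (ennreal (indicator {0..} r * r ^ (d - 1) / sqrt (1 + r\<^sup>2) ^ (d + 1)) * indicator X (1 / (1 + r\<^sup>2)))"
    if r0: "r \<noteq> 0" for r :: real
  proof (cases "r > 0")
    case r: True
    let ?a = "sqrt (1 + r\<^sup>2)"
    have a: "?a > 0" "?a\<^sup>2 = 1 + r\<^sup>2" using pos[of r] by auto
    have "\<bar>h' r\<bar> = 2 * r / (1 + r\<^sup>2)\<^sup>2"
      using r pos[of r] by (simp add: h'_def abs_mult)
    then have "\<bar>h' r\<bar> * g (h r) = 2 * (r ^ (d - 1) / ?a ^ (d + 1))"
      using beta_kernel_jacobian[OF r a d] unfolding a(2) g_def h_def by simp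
    then have "ennreal (\<bar>h' r\<bar> * g (h r)) = 2 * ennreal (r ^ (d - 1) / ?a ^ (d + 1))"
      by (simp only:) (subst ennreal_mult, use r a(1) in auto)
    then show ?thesis
      using r by (auto simp: f_def S_def h_def split: split_indicator)
  qed (use r0 in \<open>auto simp: S_def\<close>)
  have "2 * (\<integral>\<^sup>+r. ennreal (indicator {0..} r * r ^ (d - 1) / sqrt (1 + r\<^sup>2) ^ (d + 1)) * indicator X (1 / (1 + r\<^sup>2)) \<partial>lborel)
      = (\<integral>\<^sup>+r. 2 * (ennreal (indicator {0..} r * r ^ (d - 1) / sqrt (1 + r\<^sup>2) ^ (d + 1)) * indicator X (1 / (1 + r\<^sup>2))) \<partial>lborel)"
    by (rule nn_integral_cmult[symmetric]) measurable
  also have "\<dots> = (\<integral>\<^sup>+r. ennreal (\<bar>h' r\<bar> * f (h r)) * indicator S r \<partial>lborel)"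
    using AE_lborel_singleton[of "0::real"]
      by (intro nn_integral_cong_AE, eventually_elim) (subst E, simp_all)
  also have "\<dots> = ennreal b"
    using f0 by (intro nn_integral_has_integral_lebesgue' hI) simp
  also have "\<dots> = (\<integral>\<^sup>+x. ennreal (f x) * indicator {0<..<1} x \<partial>lborel)"
    using f0 by (intro nn_integral_has_integral_lebesgue'[symmetric] fI) simp
  also have "\<dots> = (\<integral>\<^sup>+x. 2 * (ennreal (Beta (1/2) (real d / 2) / 2) * ennreal (beta_density (1/2) (real d / 2) x) * indicator X x) \<partial>lborel)"
  proof (rule nn_integral_cong)
    fix x
    let ?B = "Beta (1/2) (real d / 2)"
    have "2 * (ennreal (?B / 2) * ennreal (beta_density (1/2) (real d / 2) x) * indicator X x)
        = ennreal (2 * (?B / 2)) * ennreal (beta_density (1/2) (real d / 2) x) * indicator X x"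
      using B by (subst ennreal_mult) (auto simp: mult.assoc)
    also have "\<dots> = ennreal (?B * beta_density (1/2) (real d / 2) x) * indicator X x"
      using B by (simp add: ennreal_mult')
    also have "?B * beta_density (1/2) (real d / 2) x = indicator {0<..<1} x * g x"
      using B by (simp add: beta_density_def g_def split: split_indicator)
    also have "ennreal (indicator {0<..<1} x * g x) * indicator X x = ennreal (f x) * indicator {0<..<1} x"
      by (auto simp: f_def split: split_indicator)
    finally show "ennreal (f x) * indicator {0<..<1} x
        = 2 * (ennreal (?B / 2) * ennreal (beta_density (1/2) (real d / 2) x) * indicator X x)" ..
  qed
  also have "\<dots> = 2 * (\<integral>\<^sup>+x. ennreal (Beta (1/2) (real d / 2) / 2) * ennreal (beta_density (1/2) (real d / 2) x) * indicator X x \<partial>lborel)"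
    by (rule nn_integral_cmult) (simp add: beta_density_def[abs_def])
  finally show ?thesis
    by (simp add: ennreal_mult_cancel_left)
qed

text \<open>
  The ratio \<open>S / \<bar>Y\<bar>\<close> of a chi and a normal variable has density proportional to
  \<open>r ^ (d - 1) / sqrt (1 + r\<^sup>2) ^ (d + 1)\<close>; the substitution above turns this into the beta kernel, and
  the remaining factor is 1 because both laws have mass 1.
\<close>

lemma chi_ratio_beta:
  fixes I :: "'i set"
  assumes I: "finite I" "I \<noteq> {}"
  shows "distr (mult_conv (chi_law I) inv_abs_normal) borel (\<lambda>r. 1 / (1 + r\<^sup>2))
    = density lborel (\<lambda>x. ennreal (beta_density (1/2) (real (card I) / 2) x))"
proof -
  define d where "d = card I"
  have d: "d > 0" using I by (simp add: d_def card_gt_0_iff)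
  let ?\<rho> = "mult_conv (chi_law I) inv_abs_normal"
  let ?w = "\<lambda>s::real. indicator {0..} s * s ^ (d - 1)"
  let ?\<beta> = "\<lambda>x. ennreal (beta_density (1/2) (real d / 2) x)"
  obtain c where c: "chi_law I = density lborel (\<lambda>s. c * ennreal (?w s * exp (- s\<^sup>2 / 2)))"
    using chi_law_density[OF I] unfolding d_def .
  obtain c' where c': "?\<rho> = density lborel (\<lambda>r. c' * ennreal (?w r / sqrt (1 + r\<^sup>2) ^ (d - 1 + 2)))"
    by (rule mult_conv_inv_abs_normal[OF real_distribution_chi_law[OF I(1)] c, where k = "d - 1"])
       (auto simp: power_mult_distrib zero_le_mult_iff split: split_indicator)
  have d1: "d - 1 + 2 = d + 1" using d by simp
  interpret R: real_distribution ?\<rho>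
    by (intro real_distribution_mult_conv real_distribution_chi_law I real_distribution_inv_abs_normal)
  define c'' where "c'' = c' * ennreal (Beta (1/2) (real d / 2) / 2)"
  have eq: "distr ?\<rho> borel (\<lambda>r. 1 / (1 + r\<^sup>2)) = density lborel (\<lambda>x. c'' * ?\<beta> x)"
  proof (rule measure_eqI)
    fix X assume "X \<in> sets (distr ?\<rho> borel (\<lambda>r. 1 / (1 + r\<^sup>2)))"
    then have X[measurable]: "X \<in> sets borel" by simp
    have [measurable]: "?\<beta> \<in> borel_measurable borel" by (simp add: beta_density_def[abs_def])
    have "emeasure (distr ?\<rho> borel (\<lambda>r. 1 / (1 + r\<^sup>2))) X = (\<integral>\<^sup>+r. indicator X (1 / (1 + r\<^sup>2)) \<partial>?\<rho>)"
      by (rule emeasure_distr_eq_nn_integral) measurable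
    also have "\<dots> = (\<integral>\<^sup>+r. c' * ennreal (?w r / sqrt (1 + r\<^sup>2) ^ (d + 1)) * indicator X (1 / (1 + r\<^sup>2)) \<partial>lborel)"
      unfolding c' d1 by (rule nn_integral_density) measurable
    also have "\<dots> = c' * (\<integral>\<^sup>+r. ennreal (?w r / sqrt (1 + r\<^sup>2) ^ (d + 1)) * indicator X (1 / (1 + r\<^sup>2)) \<partial>lborel)"
      unfolding mult.assoc by (rule nn_integral_cmult) measurable
    also have "\<dots> = c' * (\<integral>\<^sup>+x. ennreal (Beta (1/2) (real d / 2) / 2) * ?\<beta> x * indicator X x \<partial>lborel)"
      by (simp only: nn_integral_beta_substitution[OF d X])
    also have "\<dots> = (\<integral>\<^sup>+x. c'' * ?\<beta> x * indicator X x \<partial>lborel)"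
      unfolding c''_def mult.assoc by (rule nn_integral_cmult[symmetric]) measurable
    also have "\<dots> = emeasure (density lborel (\<lambda>x. c'' * ?\<beta> x)) X"
      by (rule emeasure_density[symmetric]) measurable
    finally show "emeasure (distr ?\<rho> borel (\<lambda>r. 1 / (1 + r\<^sup>2))) X = emeasure (density lborel (\<lambda>x. c'' * ?\<beta> x)) X" .
  qed simp
  have "prob_space (distr ?\<rho> borel (\<lambda>r. 1 / (1 + r\<^sup>2)))"
    by (intro R.prob_space_distr) measurable
  then have "c'' = 1"
    using prob_space_beta_density[of "1/2" "real d / 2"] d unfolding eq
    by (intro prob_density_scalar_unique[where f = ?\<beta> and M = lborel]) (auto simp: beta_density_def[abs_def])
  then show ?thesis using eq by (simp add: d_def)
qed


lemma distr_inverse_one_plus_square_inject: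
  assumes A: "real_distribution A" and B: "real_distribution B"
    and nA: "AE r in A. 0 \<le> r" and nB: "AE r in B. 0 \<le> r"
    and eq: "distr A borel (\<lambda>r. 1 / (1 + r\<^sup>2)) = distr B borel (\<lambda>r. 1 / (1 + r\<^sup>2))"
  shows "A = B"
proof -
  have "distr (distr D borel (\<lambda>r. 1 / (1 + r\<^sup>2))) borel (\<lambda>h. sqrt (1 / h - 1)) = D"
    if D: "real_distribution D" and nD: "AE r in D. 0 \<le> r" for D
  proof -
    interpret D: real_distribution D by fact
    have "distr (distr D borel (\<lambda>r. 1 / (1 + r\<^sup>2))) borel (\<lambda>h. sqrt (1 / h - 1)) = distr D borel (\<lambda>r. \<bar>r\<bar>)"
      by (subst distr_distr) (auto simp: comp_def)
    also have "\<dots> = distr D borel (\<lambda>r. r)"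
      using nD by (intro distr_cong_AE) auto
    also have "\<dots> = D" by (simp add: distr_id2)
    finally show ?thesis .
  qed
  from this[OF A nA] this[OF B nB] show ?thesis using eq by metis
qed

section \<open>Integration against a regular conditional law\<close>

text \<open>
  Disintegration.  The definition of a regular conditional law speaks of measurable rectangles, which
  form an intersection-stable generator of the product sigma algebra; so the joint law of \<open>(X, Y)\<close> is
  the law of \<open>X\<close> followed by the kernel \<open>\<kappa>\<close>.
\<close>

lemma nn_integral_regular_conditional_law:
  assumes M: "prob_space M" and X[measurable]: "X \<in> M \<rightarrow>\<^sub>M N" and Y[measurable]: "Y \<in> M \<rightarrow>\<^sub>M L"
    and \<kappa>: "regular_conditional_law M N L X Y \<kappa>"
    and g[measurable]: "g \<in> borel_measurable (N \<Otimes>\<^sub>M L)"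
  shows "(\<integral>\<^sup>+\<omega>. g (X \<omega>, Y \<omega>) \<partial>M) = (\<integral>\<^sup>+x. \<integral>\<^sup>+y. g (x, y) \<partial>\<kappa> x \<partial>distr M N X)"
proof -
  interpret prob_space M by fact
  have \<kappa>m[measurable]: "\<kappa> \<in> N \<rightarrow>\<^sub>M subprob_algebra L"
    using \<kappa> by (simp add: regular_conditional_law_def measurable_prob_algebraD)
  let ?K = "\<lambda>x. distr (\<kappa> x) (N \<Otimes>\<^sub>M L) (Pair x)"
  let ?J = "distr M (N \<Otimes>\<^sub>M L) (\<lambda>\<omega>. (X \<omega>, Y \<omega>))"
  let ?J' = "distr M N X \<bind> ?K"
  have K[measurable]: "?K \<in> distr M N X \<rightarrow>\<^sub>M subprob_algebra (N \<Otimes>\<^sub>M L)"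
    using measurable_distr2[of Pair N L "N \<Otimes>\<^sub>M L" \<kappa>, OF _ \<kappa>m] by simp
  have sets_\<kappa>: "sets (\<kappa> x) = sets L" if "x \<in> space N" for x
    using subprob_measurableD(2)[OF \<kappa>m that] .
  have ne: "space (distr M N X) \<noteq> {}"
    using not_empty measurable_space[OF X] by auto
  have "?J = ?J'"
  proof (rule measure_eqI_generator_eq[OF Int_stable_pair_measure_generator[of N L]])
    let ?E = "{A \<times> B |A B. A \<in> sets N \<and> B \<in> sets L}"
    show "?E \<subseteq> Pow (space N \<times> space L)"
      using sets.space_closed[of N] sets.space_closed[of L] by auto
    show "sets ?J = sigma_sets (space N \<times> space L) ?E"
      by (simp add: sets_pair_measure)
    show "sets ?J' = sigma_sets (space N \<times> space L) ?E"
      by (subst sets_bind[OF _ ne, of ?K "N \<Otimes>\<^sub>M L"]) (simp_all add: sets_pair_measure)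
    show "range (\<lambda>_::nat. space N \<times> space L) \<subseteq> ?E" by auto
    interpret J: prob_space ?J by (rule prob_space_distr) measurable
    show "emeasure ?J (space N \<times> space L) \<noteq> \<infinity>" by simp
    fix Q assume "Q \<in> ?E"
    then obtain A B where Q: "Q = A \<times> B" and [measurable]: "A \<in> sets N" "B \<in> sets L" by auto
    have "emeasure ?J Q = emeasure M {\<omega> \<in> space M. X \<omega> \<in> A \<and> Y \<omega> \<in> B}"
      unfolding Q by (subst emeasure_distr) (auto intro!: arg_cong[where f = "emeasure M"])
    also have "\<dots> = (\<integral>\<^sup>+x\<in>A. emeasure (\<kappa> x) B \<partial>distr M N X)"
      using \<kappa> by (simp add: regular_conditional_law_def)
    also have "\<dots> = (\<integral>\<^sup>+x. emeasure (?K x) Q \<partial>distr M N X)"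
    proof (rule nn_integral_cong)
      fix x assume "x \<in> space (distr M N X)"
      then have x: "x \<in> space N" by simp
      have "emeasure (?K x) Q = emeasure (\<kappa> x) (Pair x -` Q \<inter> space (\<kappa> x))"
        unfolding Q using x
        by (intro emeasure_distr) (auto cong: measurable_cong_sets simp: measurable_cong_sets[OF sets_\<kappa>[OF x] refl])
      also have "Pair x -` Q \<inter> space (\<kappa> x) = (if x \<in> A then B else {})"
        using sets.sets_into_space[OF \<open>B \<in> sets L\<close>] sets_eq_imp_space_eq[OF sets_\<kappa>[OF x]] by (auto simp: Q)
      finally show "emeasure (\<kappa> x) B * indicator A x = emeasure (?K x) Q"
        by (simp add: indicator_def)
    qed
    also have "\<dots> = emeasure ?J' Q"
      unfolding Q by (rule emeasure_bind[symmetric, OF ne K]) measurable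
    finally show "emeasure ?J Q = emeasure ?J' Q" .
  qed auto
  moreover have "(\<integral>\<^sup>+\<omega>. g (X \<omega>, Y \<omega>) \<partial>M) = (\<integral>\<^sup>+z. g z \<partial>?J)"
    by (rule nn_integral_distr[symmetric]) measurable
  ultimately have "(\<integral>\<^sup>+\<omega>. g (X \<omega>, Y \<omega>) \<partial>M) = (\<integral>\<^sup>+z. g z \<partial>?J')" by simp
  also have "\<dots> = (\<integral>\<^sup>+x. \<integral>\<^sup>+z. g z \<partial>?K x \<partial>distr M N X)"
    by (rule nn_integral_bind[OF g K])
  also have "\<dots> = (\<integral>\<^sup>+x. \<integral>\<^sup>+y. g (x, y) \<partial>\<kappa> x \<partial>distr M N X)"
  proof (rule nn_integral_cong)
    fix x assume "x \<in> space (distr M N X)"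
    then have x: "x \<in> space N" by simp
    have "Pair x \<in> \<kappa> x \<rightarrow>\<^sub>M N \<Otimes>\<^sub>M L"
      using x by (subst measurable_cong_sets[OF sets_\<kappa>[OF x] refl]) measurable
    then show "(\<integral>\<^sup>+z. g z \<partial>?K x) = (\<integral>\<^sup>+y. g (x, y) \<partial>\<kappa> x)"
      by (rule nn_integral_distr) measurable
  qed
  finally show ?thesis .
qed

section \<open>The equivalence\<close>

lemma dim_orthogonal_comp_singleton:
  fixes u :: "'a::euclidean_space"
  assumes "u \<noteq> 0"
  shows "dim (orthogonal_comp {u}) = DIM('a) - 1"
  using dim_hyperplane[OF assms] by (simp add: orthogonal_comp_singleton)


theorem theorem5p1:
  fixes M :: "'w measure"
    and U V :: "'w \<Rightarrow> real ^ 'n"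
    and T :: "real ^ 'n \<Rightarrow> real ^ 'n"
    and \<kappa> :: "real ^ 'n \<Rightarrow> (real ^ 'n) measure"
    and R Z H :: "'w \<Rightarrow> real"
  assumes "CARD('n) \<ge> 2"
    and "prob_space M"
    and "U \<in> M \<rightarrow>\<^sub>M unit_sphere_borel"
    and "haar_uniform_on_unit_sphere UNIV (distr M borel U)"
    and "T \<in> unit_sphere_borel \<rightarrow>\<^sub>M borel"
    and "AE u in distr M unit_sphere_borel U. u \<bullet> T u = 0"
    and "V \<in> M \<rightarrow>\<^sub>M borel"
    and "regular_conditional_law M unit_sphere_borel borel U V \<kappa>"
    and "AE u in distr M unit_sphere_borel U.
           haar_uniform_on_unit_sphere (orthogonal_comp {u}) (\<kappa> u)"
    and "\<And>\<omega>. R \<omega> = norm (T (U \<omega>))"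
    and "\<And>\<omega>. Z \<omega> = T (U \<omega>) \<bullet> V \<omega>"
    and "\<And>\<omega>. H \<omega> = 1 / (1 + (R \<omega>)\<^sup>2)"
  shows "distributed M lborel H (\<lambda>x. ennreal (beta_density (1/2) ((real CARD('n) - 1) / 2) x)) \<longleftrightarrow>
         distributed M lborel Z (\<lambda>x. ennreal (cauchy_density 0 1 x))"
proof -
  interpret prob_space M by fact
  note [measurable] = assms(3,5,7)
  let ?N = "unit_sphere_borel :: (real ^ 'n) measure"
  let ?L = "distr M ?N U"
  interpret L: prob_space ?L by (rule prob_space_distr) measurable
  have "R = (\<lambda>\<omega>. norm (T (U \<omega>)))" "Z = (\<lambda>\<omega>. T (U \<omega>) \<bullet> V \<omega>)" "H = (\<lambda>\<omega>. 1 / (1 + (R \<omega>)\<^sup>2))"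
    using assms(10-12) by auto
  then have [measurable]: "R \<in> borel_measurable M" "Z \<in> borel_measurable M" "H \<in> borel_measurable M"
    by simp_all
  have good: "AE u in ?L. norm u = 1 \<and> T u \<in> orthogonal_comp {u} \<and>
      haar_uniform_on_unit_sphere (orthogonal_comp {u}) (\<kappa> u)"
    using AE_space[of ?L] assms(6,9)
    by eventually_elim (auto simp: orthogonal_comp_singleton space_restrict_space)
  obtain u where u: "norm u = 1" "haar_uniform_on_unit_sphere (orthogonal_comp {u}) (\<kappa> u)"
    using eventually_happens'[OF L.ae_filter_bot good] by blast
  let ?S = "orthogonal_comp {u}"
  obtain B where B: "B \<subseteq> ?S" "pairwise orthogonal B" "\<And>x. x \<in> B \<Longrightarrow> norm x = 1"
    "independent B" "card B = dim ?S" "span B = ?S"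
    using orthonormal_basis_subspace[OF subspace_orthogonal_comp[of "{u}"]] by metis
  have card: "card B = CARD('n) - 1"
    using B(5) dim_orthogonal_comp_singleton[of u] norm_zero u(1) by fastforce
  have fin: "finite B" using B(4) by (rule independent_imp_finite)
  have "B \<noteq> {}" using card assms(1) by auto
  then obtain e where e: "e \<in> ?S" "norm e = 1" using B(1,3) by blast
  define \<omega> where "\<omega> = distr (\<kappa> u) borel ((\<bullet>) e)"
  define \<rho> where "\<rho> = distr M borel R"
  \<comment> \<open>The law of \<open>S / \<bar>Y\<bar>\<close>, to which both sides of the equivalence will be reduced.\<close>
  define \<rho>0 where "\<rho>0 = mult_conv (chi_law B) inv_abs_normal"
  let ?N1 = "std_normal_distribution"
  let ?C = "density lborel (\<lambda>x. ennreal (cauchy_density 0 1 x))"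
  let ?Be = "density lborel (\<lambda>x. ennreal (beta_density (1/2) ((real CARD('n) - 1) / 2) x))"
  have \<omega>[simp]: "real_distribution \<omega>"
    unfolding \<omega>_def
    by (rule prob_space.real_distribution_distr)
       (simp_all add: haar_uniform_measurable_eq[OF u(2)])
  have \<chi>[simp]: "real_distribution (chi_law B)" by (rule real_distribution_chi_law[OF fin])
  have \<iota>[simp]: "real_distribution inv_abs_normal" by (rule real_distribution_inv_abs_normal)
  have N1[simp]: "real_distribution ?N1" by (rule real_dist_normal_dist)
  have \<rho>[simp]: "real_distribution \<rho>" unfolding \<rho>_def by (rule real_distribution_distr) measurable
  have \<rho>0[simp]: "real_distribution \<rho>0" unfolding \<rho>0_def by (intro real_distribution_mult_conv \<chi> \<iota>)
  have \<rho>_nonneg: "AE r in \<rho>. 0 \<le> r"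
    unfolding \<rho>_def by (subst AE_distr_iff) (auto simp: assms(10))
  have \<rho>0_nonneg: "AE r in \<rho>0. 0 \<le> r"
    unfolding \<rho>0_def
  proof (rule AE_mult_conv_nonneg[OF \<chi> \<iota>])
    show "AE x in chi_law B. 0 \<le> x"
      unfolding chi_law_def by (subst AE_distr_iff) (auto simp: sum_nonneg)
    show "AE x in inv_abs_normal. 0 \<le> x"
      unfolding inv_abs_normal_def by (subst AE_distr_iff) auto
  qed

  have law_Z: "distr M borel Z = mult_conv \<rho> \<omega>"
  proof (rule measure_eqI)
    fix X assume "X \<in> sets (distr M borel Z)"
    then have X[measurable]: "X \<in> sets borel" by simp
    interpret W: real_distribution \<omega> by (rule \<omega>)
    let ?g = "\<lambda>(u, v). indicator X (T u \<bullet> v) :: ennreal"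
    have g[measurable]: "?g \<in> borel_measurable (?N \<Otimes>\<^sub>M borel)" by measurable
    have "emeasure (distr M borel Z) X = (\<integral>\<^sup>+\<omega>. ?g (U \<omega>, V \<omega>) \<partial>M)"
      by (subst emeasure_distr_eq_nn_integral) (simp_all add: assms(11))
    also have "\<dots> = (\<integral>\<^sup>+x. \<integral>\<^sup>+y. ?g (x, y) \<partial>\<kappa> x \<partial>?L)"
      by (rule nn_integral_regular_conditional_law[OF assms(2,3,7,8) g])
    also have "\<dots> = (\<integral>\<^sup>+x. \<integral>\<^sup>+w. indicator X (norm (T x) * w) \<partial>\<omega> \<partial>?L)"
    proof (rule nn_integral_cong_AE)
      show "AE x in ?L. (\<integral>\<^sup>+y. ?g (x, y) \<partial>\<kappa> x) = (\<integral>\<^sup>+w. indicator X (norm (T x) * w) \<partial>\<omega>)"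
        using good
      proof eventually_elim
        case (elim x)
        then have "(\<integral>\<^sup>+v. indicator X (T x \<bullet> v) \<partial>\<kappa> x)
            = (\<integral>\<^sup>+w. indicator X (norm (T x) * w) \<partial>distr (\<kappa> u) borel ((\<bullet>) e))"
          using u e by (intro haar_uniform_inner_scale[where u = x and u' = u]) auto
        then show ?case by (simp add: \<omega>_def)
      qed
    qed
    also have "\<dots> = (\<integral>\<^sup>+\<omega>'. \<integral>\<^sup>+w. indicator X (R \<omega>' * w) \<partial>\<omega> \<partial>M)"
      by (subst nn_integral_distr) (simp_all add: assms(10))
    also have "\<dots> = (\<integral>\<^sup>+r. \<integral>\<^sup>+w. indicator X (r * w) \<partial>\<omega> \<partial>\<rho>)"
      unfolding \<rho>_def by (rule nn_integral_distr[symmetric]) measurable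
    also have "\<dots> = emeasure (mult_conv \<rho> \<omega>) X"
      by (rule emeasure_mult_conv[symmetric]) simp_all
    finally show "emeasure (distr M borel Z) X = emeasure (mult_conv \<rho> \<omega>) X" .
  qed (simp add: mult_conv_def)

  have chi_\<omega>: "mult_conv (chi_law B) \<omega> = ?N1"
    unfolding \<omega>_def
    by (rule chi_law_mult_haar[OF u(2) subspace_orthogonal_comp e B(2-4) B(6)])
  \<comment> \<open>Reassociate \<open>(S / \<bar>Y\<bar>) * W\<close> as \<open>(S * W) / \<bar>Y\<bar>\<close>.\<close>
  have \<rho>0_cauchy: "mult_conv \<rho>0 \<omega> = ?C"
  proof -
    have "mult_conv \<rho>0 \<omega> = mult_conv (mult_conv inv_abs_normal (chi_law B)) \<omega>"
      unfolding \<rho>0_def by (subst mult_conv_commute) simp_all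
    also have "\<dots> = mult_conv inv_abs_normal ?N1"
      by (simp add: mult_conv_assoc chi_\<omega>)
    also have "\<dots> = mult_conv ?N1 inv_abs_normal"
      by (rule mult_conv_commute) simp_all
    finally show ?thesis by (simp only: std_normal_ratio_cauchy)
  qed
  \<comment> \<open>Multiplying by an independent chi variable replaces the factor \<open>W\<close> by a normal one.\<close>
  have smooth: "mult_conv A ?N1 = mult_conv (chi_law B) (mult_conv A \<omega>)" if A: "real_distribution A" for A
  proof -
    have "mult_conv A ?N1 = mult_conv (mult_conv A (chi_law B)) \<omega>"
      using A by (simp add: mult_conv_assoc chi_\<omega>)
    also have "\<dots> = mult_conv (mult_conv (chi_law B) A) \<omega>"
      using A by (subst mult_conv_commute) simp_all
    finally show ?thesis using A by (simp add: mult_conv_assoc)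
  qed
  have Z_iff: "distr M borel Z = ?C \<longleftrightarrow> \<rho> = \<rho>0"
  proof
    assume "distr M borel Z = ?C"
    then have "mult_conv \<rho> \<omega> = mult_conv \<rho>0 \<omega>" by (simp only: law_Z \<rho>0_cauchy)
    then have "mult_conv \<rho> ?N1 = mult_conv \<rho>0 ?N1" by (simp only: smooth \<rho> \<rho>0)
    then show "\<rho> = \<rho>0"
      by (rule mult_conv_std_normal_cancel[OF \<rho> \<rho>0 \<rho>_nonneg \<rho>0_nonneg])
  qed (simp only: law_Z \<rho>0_cauchy)

  have law_H: "distr M borel H = distr \<rho> borel (\<lambda>r. 1 / (1 + r\<^sup>2))"
    unfolding \<rho>_def by (subst distr_distr) (auto simp: comp_def assms(12) intro!: distr_cong)
  have beta: "distr \<rho>0 borel (\<lambda>r. 1 / (1 + r\<^sup>2)) = ?Be"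
    using chi_ratio_beta[OF fin \<open>B \<noteq> {}\<close>] assms(1) by (simp add: card \<rho>0_def of_nat_diff)
  have H_iff: "distr M borel H = ?Be \<longleftrightarrow> \<rho> = \<rho>0"
    unfolding law_H beta[symmetric]
    using distr_inverse_one_plus_square_inject[OF \<rho> \<rho>0 \<rho>_nonneg \<rho>0_nonneg] by blast
  have lb: "distr M lborel f = distr M borel f" for f :: "'w \<Rightarrow> real"
    by (rule distr_cong) simp_all
  show ?thesis
    unfolding distributed_def lb H_iff Z_iff
    by (simp add: beta_density_def[abs_def] cauchy_density_def[abs_def])
qed

end
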